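(* Let $s$ and $r$ be positive integers and $a\in\Bbbk-\{0\}$. Then for $f\in R^{\circ}_r(\zeta)$ with $f=a\zeta^{-s/r}+\underline{o}(\zeta^{-s/r})$ we have $$\mathcal{M}^{(\infty,\infty)}(E_f)\simeq D_g,$$ where $g\in S^{\circ}_{s}(\theta)$ is determined by the following system of equations: $$f=-\theta^{-1},$$ $$g=z-(-a)^{-r/s}\left(\frac{r+s}{2s}\right)\theta^{1-(r/s)}.$$
   Context: $\Bbbk$ is an algebraically closed field of characteristic zero. The notation $\underline{o}(\zeta^{k})$ denotes a series all of whose terms have order $>k$; $\mathrm{ord}$ is the order of vanishing of a (Puiseux-)Laurent series. **Connections at infinity.** Let $\zeta=1/z$ and $K=\Bbbk((\zeta))$. Objects of $\mathcal{C}_\infty$ are pairs $(V,\nabla)$ with $V$ a finite-dimensional $K$-vector space and $\nabla$ a connection, written with respect to the coordinate $z$: $\nabla=\nabla_z:V\to V$ is $\Bbbk$-linear with $\nabla(hv)=h\nabla(v)+\frac{dh}{dz}v$ for $h\in K$, where $\frac{d}{dz}=-\zeta^2\frac{d}{d\zeta}$ (thus $\nabla_z=-\zeta^2\nabla_\zeta$, where $\nabla_\zeta$ is the connection with respect to $\zeta$). For $q\ge1$ let $K_q=\Bbbk((\zeta^{1/q}))$; for $f\in K_q$ the object $E_f\in\mathcal{C}_\infty$ is $K_q$, viewed over $K$, with $\nabla=\frac{d}{dz}+z^{-1}f=-\zeta^2\frac{d}{d\zeta}+\zeta f$. Let $R_q=R_q(\zeta)$ be the set of orbits of $\mathrm{Gal}(K_q/K)$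 (acting by $\zeta^{1/q}\mapsto\eta\zeta^{1/q}$, $\eta^q=1$) on $K_q/\left(\zeta^{1/q}\Bbbk[[\zeta^{1/q}]]+\frac{\mathbb{Z}}{q}\right)$, and let $R_q^\circ\subset R_q$ be the set of those classes that cannot be represented by elements of $K_{q'}$ for any $0<q'<q$. The isomorphism class of $E_f$ depends only on the class of $f$ in $R_q$, and $f\in R^\circ_q$ is identified with a representative in $K_q$. The $E_f$ with $f\in R_q^\circ$, $q\geq1$, are exactly the irreducible objects up to isomorphism. $\mathcal{C}_\infty^{>0}$ is the full subcategory of objects whose irreducible components $E_f$ all have slope greater than zero, i.e. $\mathrm{ord}(f)<0$. **Difference operators.** Over $\Bbbk((\theta))$, let $\varphi$ be the $\Bbbk$-automorphism $\varphi(v(\theta))=v\left(\frac{\theta}{1+\theta}\right)$, extended to $\Bbbk((\theta^{1/q}))$ by $\varphi(v(\theta^{1/q}))=v\left(\theta^{1/q}\sum_{i\ge0}\binom{-1/q}{i}\theta^i\right)$. Objects of $\mathcal{N}$ are pairs $(V,\Phi)$, $V$ a finite-dimensional $\Bbbk((\theta))$-vector space and $\Phi:V\to V$ an invertible $\Bbbk$-linear map with $\Phi(hv)=\varphi(h)\Phi(v)$ for all $h\in\Bbbk((\theta))$; morphisms are $\Bbbk((\theta))$-linear maps commuting with the $\Phi$'s. For $g\in\Bbbk((\theta^{1/q}))^*$ set $D_g=(\Bbbk((\theta^{1/q})),g\varphi)$, viewed over $\Bbbk((\theta))$. Let $S_q=S_q(\theta)$ be the set of orbits of $\mathrm{Gal}(\Bbbk((\theta^{1/q}))/\Bbbk((\theta)))$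 on the multiplicative quotient $\Bbbk((\theta^{1/q}))^*/\left(1+\frac{\mathbb{Z}}{q}\theta+\theta^{1+(1/q)}\Bbbk[[\theta^{1/q}]]\right)$, and $S_q^\circ\subset S_q$ the set of classes that cannot be represented by elements of $\Bbbk((\theta^{1/q'}))^*$ for any $0<q'<q$. The isomorphism class of $D_g$ depends only on the class of $g$ in $S_q$. **Local Mellin transform.** For $E=(V,\nabla)\in\mathcal{C}_\infty^{>0}$ put $\theta:=-(z\nabla)^{-1}:V\to V$ and $\Phi:=z=\zeta^{-1}:V\to V$. Then $\theta$ extends to an action of $\Bbbk((\theta))$ on $V$ (compatible with the topology: the $\theta$-adic topology on $V$ coincides with the $\zeta$-adic topology), $V$ is finite-dimensional over $\Bbbk((\theta))$ (written $V_\theta$), $\Phi$ is an invertible difference operator, and $\mathcal{M}^{(\infty,\infty)}(E):=(V_\theta,\Phi)\in\mathcal{N}$. **How the system determines $g$.** In the system $z=\zeta^{-1}$ and $\theta$ are commuting formal variables. The equation $f=-\theta^{-1}$ is solved explicitly for $z$ as an element of $\Bbbk((\theta^{1/s}))$, with leading term $(-a)^{-r/s}\theta^{-r/s}$ (the symbol $(-a)^{-r/s}$ in the second equation is this same leading coefficient); this is substituted into the second equation to give $g\in\Bbbk((\theta^{1/s}))$. Different choices of roots give the same Galois orbit. *)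

theory Defs
  imports "HOL-Computational_Algebra.Computational_Algebra"
begin

text \<open>
  Puiseux--Laurent series: an element of \<open>k((x\<^sup>1\<^sup>/\<^sup>q))\<close> is represented by a formal Laurent series
  in the uniformizer \<open>x\<^sup>1\<^sup>/\<^sup>q\<close> (so \<open>x\<close> itself is \<open>fls_X ^ q\<close>), with \<open>q \<ge> 1\<close> given separately.
  The inclusion of \<open>k((x))\<close> is \<open>\<lambda>h. fls_compose_power h q\<close>.
  Every order below is measured in powers of the uniformizer.
\<close>

definition small_o :: "int \<Rightarrow> 'a::zero fls set" where
  "small_o k = {p. \<forall>n\<le>k. fls_nth p n = 0}"

text \<open>The elements of \<open>k((x\<^sup>1\<^sup>/\<^sup>q))\<close> that lie in \<open>k((x\<^sup>1\<^sup>/\<^sup>p))\<close>, i.e. all of whose exponents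
  \<open>n/q\<close> are in \<open>(1/p)\<int>\<close>.\<close>

definition in_subfield :: "nat \<Rightarrow> nat \<Rightarrow> 'a::zero fls set" where
  "in_subfield q p = {v. \<forall>n. fls_nth v n \<noteq> 0 \<longrightarrow> int q dvd n * int p}"

text \<open>The substitution \<open>x\<^sup>1\<^sup>/\<^sup>q \<mapsto> \<eta> x\<^sup>1\<^sup>/\<^sup>q\<close>; it is a Galois automorphism when \<open>\<eta> ^ q = 1\<close>.\<close>

definition galois :: "'a::field \<Rightarrow> 'a fls \<Rightarrow> 'a fls" where
  "galois \<eta> v = fls_compose_fps v (fps_const \<eta> * fps_X)"


section \<open>The parameter sets \<open>R\<close> and \<open>S\<close>\<close>

text \<open>Two elements are related iff they represent the same Galois orbit in the quotient by
  \<open>\<zeta>\<^sup>1\<^sup>/\<^sup>q k[[\<zeta>\<^sup>1\<^sup>/\<^sup>q]] + \<int>/q\<close>. An element of \<open>R_set q\<close> is thus the full preimage in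
  \<open>k((\<zeta>\<^sup>1\<^sup>/\<^sup>q))\<close> of such an orbit.\<close>

definition R_rel :: "nat \<Rightarrow> ('a::field fls \<times> 'a fls) set" where
  "R_rel q = {(f, f'). \<exists>\<eta> (m::int). \<exists>p \<in> small_o 0. \<eta> ^ q = 1 \<and>
     f' = galois \<eta> f + fls_const (of_int m / of_nat q) + p}"

definition R_set :: "nat \<Rightarrow> 'a::field fls set set" where
  "R_set q = UNIV // R_rel q"

definition R_circ :: "nat \<Rightarrow> 'a::field fls set set" where
  "R_circ q = {C \<in> R_set q. \<forall>q'. 0 < q' \<and> q' < q \<longrightarrow> C \<inter> in_subfield q q' = {}}"

text \<open>The subgroup \<open>1 + (\<int>/q) \<theta> + \<theta>\<^sup>1\<^sup>+\<^sup>1\<^sup>/\<^sup>q k[[\<theta>\<^sup>1\<^sup>/\<^sup>q]]\<close> of \<open>k((\<theta>\<^sup>1\<^sup>/\<^sup>q))\<^sup>*\<close>.\<close>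

definition S_subgroup :: "nat \<Rightarrow> 'a::field fls set" where
  "S_subgroup q = {1 + fls_const (of_int m / of_nat q) * fls_X ^ q + p | (m::int) p.
     p \<in> small_o (int q)}"

definition S_rel :: "nat \<Rightarrow> ('a::field fls \<times> 'a fls) set" where
  "S_rel q = {(g, g'). g \<noteq> 0 \<and> g' \<noteq> 0 \<and>
     (\<exists>\<eta>. \<exists>h \<in> S_subgroup q. \<eta> ^ q = 1 \<and> g' = galois \<eta> g * h)}"

definition S_set :: "nat \<Rightarrow> 'a::field fls set set" where
  "S_set q = (- {0}) // S_rel q"

definition S_circ :: "nat \<Rightarrow> 'a::field fls set set" where
  "S_circ q = {C \<in> S_set q. \<forall>q'. 0 < q' \<and> q' < q \<longrightarrow> C \<inter> in_subfield q q' = {}}"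


section \<open>Connections at infinity\<close>

text \<open>The derivation \<open>d/dz = - \<zeta>\<^sup>2 d/d\<zeta>\<close> on \<open>k((\<zeta>\<^sup>1\<^sup>/\<^sup>q))\<close>. With \<open>t = \<zeta>\<^sup>1\<^sup>/\<^sup>q\<close> one has
  \<open>d/d\<zeta> = (1/q) t\<^sup>1\<^sup>-\<^sup>q d/dt\<close>, hence \<open>d/dz = - (1/q) t\<^sup>q\<^sup>+\<^sup>1 d/dt\<close>.\<close>

definition d_dz :: "nat \<Rightarrow> 'a::field fls \<Rightarrow> 'a fls" where
  "d_dz q v = - (fls_const (1 / of_nat q) * fls_X ^ (q + 1) * fls_deriv v)"

text \<open>The vector space underlying an object is a whole type; the field of scalars is \<open>k((\<zeta>))\<close>.\<close>

record (overloaded) ('a, 'v) conn =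
  conn_scale :: "'a fls \<Rightarrow> 'v \<Rightarrow> 'v"
  conn_nabla :: "'v \<Rightarrow> 'v"

definition is_conn :: "('a::field, 'v::ab_group_add) conn \<Rightarrow> bool" where
  "is_conn E \<longleftrightarrow>
     (\<exists>B. finite_dimensional_vector_space (conn_scale E) B) \<and>
     (\<forall>v w. conn_nabla E (v + w) = conn_nabla E v + conn_nabla E w) \<and>
     (\<forall>h v. conn_nabla E (conn_scale E h v) =
        conn_scale E h (conn_nabla E v) + conn_scale E (d_dz 1 h) v)"

definition E_obj :: "nat \<Rightarrow> 'a::field fls \<Rightarrow> ('a, 'a fls) conn" where
  "E_obj q f = \<lparr>conn_scale = (\<lambda>h v. fls_compose_power h q * v),
                conn_nabla = (\<lambda>v. d_dz q v + fls_X ^ q * f * v)\<rparr>"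

lemma d_dz_nth: "fls_nth (d_dz q v) n = - (of_int (n - int q) / of_nat q) * fls_nth v (n - int q)"
proof -
  have "fls_X ^ (q+1) * fls_deriv v = fls_shift (- int (q+1)) (fls_deriv v)"
    by (simp only: fls_X_power_times_conv_shift)
  then have "fls_nth (fls_const (1 / of_nat q) * (fls_X ^ (q+1) * fls_deriv v)) n
     = of_int (n - int q) / of_nat q * fls_nth v (n - int q)"
    by (simp del: power_Suc of_int_diff)
  then show ?thesis by (simp add: d_dz_def mult.assoc)
qed

lemma d_dz_product: "d_dz q (v * w) = v * d_dz q w + d_dz q v * w"
  by (simp add: d_dz_def algebra_simps)

lemma d_dz_compose_power:
  fixes h :: "'a::field_char_0 fls"
  assumes "q > 0"
  shows "d_dz q (fls_compose_power h q) = fls_compose_power (d_dz 1 h) q"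
proof (rule fls_eqI)
  fix n
  show "fls_nth (d_dz q (fls_compose_power h q)) n = fls_nth (fls_compose_power (d_dz 1 h) q) n"
  proof (cases "int q dvd n")
    case True
    then obtain k where n: "n = int q * k" by blast
    have "n - int q = int q * (k - 1)" using n by (simp add: algebra_simps)
    then show ?thesis using assms n by (simp add: d_dz_nth fls_nth_compose_power)
  next
    case False
    then have "\<not> int q dvd n - int q" by (metis dvd_add_triv_right_iff diff_add_cancel)
    then show ?thesis using assms False by (simp add: d_dz_nth fls_nth_compose_power)
  qed
qed

lemma Kq_finite_dimensional:
  assumes q: "q > 0"
  shows "\<exists>B. finite_dimensional_vector_space (\<lambda>h v. fls_compose_power h q * (v :: 'a::field fls)) B"
proof -
  interpret vs: vector_space "\<lambda>h v. fls_compose_power h q * (v :: 'a::field fls)"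
    using q by unfold_locales (simp_all add: algebra_simps)
  let ?B = "(\<lambda>i. fls_X ^ i :: 'a fls) ` {..<q}"
  have "v \<in> vs.span ?B" for v :: "'a fls"
  proof -
    define c where "c i = Abs_fls (\<lambda>n. fls_nth v (int q * n + int i))" for i
    have c: "fls_nth (c i) n = fls_nth v (int q * n + int i)" if "i < q" for i n
      unfolding c_def
    proof (rule nth_Abs_fls_lower_bound[where N = "- \<bar>fls_subdegree v\<bar> - 1"], intro allI impI)
      fix n assume n: "n < - \<bar>fls_subdegree v\<bar> - 1"
      show "fls_nth v (int q * n + int i) = 0" using that
      proof (rule_tac fls_eq0_below_subdegree)
        have "int q * n + int i < int q * (n + 1)" using that by (simp add: algebra_simps)
        also have "\<dots> \<le> 1 * (n + 1)" using n q by (intro mult_right_mono_neg) auto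
        finally show "int q * n + int i < fls_subdegree v"
          using n abs_ge_minus_self[of "fls_subdegree v"] by simp
      qed
    qed
    have "v = (\<Sum>i<q. fls_compose_power (c i) q * fls_X ^ i)"
    proof (rule fls_eqI)
      fix n
      have "fls_nth (fls_compose_power (c i) q * fls_X ^ i) n =
          (if i = nat (n mod int q) then fls_nth v n else 0)" if "i < q" for i
      proof -
        have "fls_nth (fls_compose_power (c i) q * fls_X ^ i) n = 
          fls_nth (fls_compose_power (c i) q) (n - int i)"
          by (simp add: fls_X_power_times_conv_shift)
        also have "\<dots> = (if i = nat (n mod int q) then fls_nth v n else 0)"
        proof (cases "int q dvd n - int i")
          case True
          then obtain k where k: "n - int i = int q * k" by blast
          have m: "n mod int q = int i" using k that
            by (metis Euclidean_Rings.pos_mod_bound diff_eq_eq mod_mult_self2 add.commute mod_pos_pos_trivial of_nat_0_le_iff of_nat_less_iff)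
          have n: "int q * k + int i = n" using k by simp
          have "fls_nth (fls_compose_power (c i) q) (n - int i) = fls_nth v n"
            using q k by (simp add: fls_nth_compose_power c[OF that] n)
          then show ?thesis using m by simp
        next
          case False
          then have "n mod int q \<noteq> int i" by (metis mod_eq_dvd_iff mod_mod_trivial)
          then have "i \<noteq> nat (n mod int q)" using q by (metis int_nat_eq of_nat_0_less_iff pos_mod_sign)
          then show ?thesis using False q by (simp add: fls_nth_compose_power)
        qed
        finally show ?thesis .
      qed
      then have "fls_nth (\<Sum>i<q. fls_compose_power (c i) q * fls_X ^ i) n = 
         (\<Sum>i<q. if i = nat (n mod int q) then fls_nth v n else 0)"
        by (simp add: fls_nth_sum)
      also have "\<dots> = fls_nth v n" using q by (simp add: nat_less_iff)
      finally show "fls_nth v n = fls_nth (\<Sum>i<q. fls_compose_power (c i) q * fls_X ^ i) n" ..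
    qed
    also have "\<dots> \<in> vs.span ?B"
      by (intro vs.span_sum vs.span_scale vs.span_base) auto
    finally show ?thesis .
  qed
  then have sp: "vs.span ?B = UNIV" by auto
  obtain B where B: "B \<subseteq> ?B" "vs.independent B" "?B \<subseteq> vs.span B"
    by (rule vs.maximal_independent_subset)
  have "vs.span B = UNIV" using sp B(3) vs.span_mono[OF B(3)] vs.span_span by auto
  moreover have "finite B" using B(1) finite_subset by blast
  ultimately have "finite_dimensional_vector_space (\<lambda>h v. fls_compose_power h q * (v :: 'a::field fls)) B"
    using B(2) by unfold_locales auto
  then show ?thesis ..
qed

lemma is_conn_E_obj:
  fixes f :: "'a::field_char_0 fls"
  assumes "q > 0"
  shows "is_conn (E_obj q f)"
  using Kq_finite_dimensional[OF assms, where 'a='a] d_dz_compose_power[OF assms]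
  by (auto simp: is_conn_def E_obj_def d_dz_product algebra_simps) (simp add: d_dz_def algebra_simps)


section \<open>Difference operators\<close>

text \<open>\<open>phi_ext q\<close> is the substitution \<open>\<theta>\<^sup>1\<^sup>/\<^sup>q \<mapsto> \<theta>\<^sup>1\<^sup>/\<^sup>q (1 + \<theta>)\<^sup>-\<^sup>1\<^sup>/\<^sup>q\<close>.\<close>

definition phi :: "'a::field fls \<Rightarrow> 'a fls" where
  "phi v = fls_compose_fps v (fps_X / (1 + fps_X))"

definition phi_ext :: "nat \<Rightarrow> 'a::field_char_0 fls \<Rightarrow> 'a fls" where
  "phi_ext q v = fls_compose_fps v
     (fps_X * fps_compose (fps_binomial (- (1 / of_nat q))) (fps_X ^ q))"

lemma phi_ext_one: "phi_ext 1 v = phi (v::'a::field_char_0 fls)"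
proof -
  have "(1 + fps_X) * fps_binomial (-1) = (1 :: 'a fps)"
    using fps_binomial_add_mult[of "1::'a" "-1"] by (simp add: fps_binomial_1)
  then have "fps_X = (fps_X * fps_binomial (-1)) * (1 + fps_X :: 'a fps)"
    by (simp add: mult.assoc) (simp add: mult.commute)
  moreover have "(1 + fps_X :: 'a fps) \<noteq> 0"
    by (metis fps_X_nth fps_add_nth fps_one_nth fps_zero_nth add.right_neutral one_neq_zero zero_neq_one)
  ultimately have "fps_X / (1 + fps_X :: 'a fps) = fps_X * fps_binomial (-1)"
    by (metis nonzero_mult_div_cancel_right)
  then show ?thesis by (simp add: phi_ext_def phi_def)
qed

record (overloaded) ('a, 'v) diff_mod =
  dm_scale :: "'a fls \<Rightarrow> 'v \<Rightarrow> 'v"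
  dm_Phi :: "'v \<Rightarrow> 'v"

text \<open>Objects of \<open>\<N>\<close>; \<open>k\<close>-linearity of \<open>\<Phi>\<close> is additivity together with semilinearity over the
  constants, which \<open>\<phi>\<close> fixes.\<close>

definition is_diff_mod :: "('a::field, 'v::ab_group_add) diff_mod \<Rightarrow> bool" where
  "is_diff_mod N \<longleftrightarrow>
     (\<exists>B. finite_dimensional_vector_space (dm_scale N) B) \<and>
     bij (dm_Phi N) \<and>
     (\<forall>v w. dm_Phi N (v + w) = dm_Phi N v + dm_Phi N w) \<and>
     (\<forall>h v. dm_Phi N (dm_scale N h v) = dm_scale N (phi h) (dm_Phi N v))"

definition diff_mod_iso ::
  "('a::field, 'v::ab_group_add) diff_mod \<Rightarrow> ('a, 'w::ab_group_add) diff_mod \<Rightarrow> bool"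
  (infix \<open>\<simeq>\<^sub>N\<close> 50) where
  "M \<simeq>\<^sub>N N \<longleftrightarrow> is_diff_mod M \<and> is_diff_mod N \<and>
     (\<exists>T. Vector_Spaces.linear (dm_scale M) (dm_scale N) T \<and> bij T \<and>
        (\<forall>v. T (dm_Phi M v) = dm_Phi N (T v)))"

definition D_obj :: "nat \<Rightarrow> 'a::field_char_0 fls \<Rightarrow> ('a, 'a fls) diff_mod" where
  "D_obj q g = \<lparr>dm_scale = (\<lambda>h v. fls_compose_power h q * v),
                dm_Phi = (\<lambda>v. g * phi_ext q v)\<rparr>"


section \<open>The local Mellin transform\<close>

text \<open>The \<open>k[[\<zeta>]]\<close>-lattices of a finite-dimensional \<open>k((\<zeta>))\<close>-space: the \<open>k[[\<zeta>]]\<close>-spans of finite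
  generating sets. They form a basis of neighbourhoods of \<open>0\<close> for the \<open>\<zeta>\<close>-adic topology
  (together with \<open>L\<close>, every \<open>\<zeta>\<^sup>n L\<close> is one).\<close>

definition is_lattice :: "('a::field fls \<Rightarrow> 'v \<Rightarrow> 'v::ab_group_add) \<Rightarrow> 'v set \<Rightarrow> bool" where
  "is_lattice scale L \<longleftrightarrow>
     (\<exists>B. finite B \<and> module.span scale B = UNIV \<and>
        L = range (\<lambda>c :: 'v \<Rightarrow> 'a fps. \<Sum>b\<in>B. scale (fps_to_fls (c b)) b))"

definition adic_limit ::
  "('a::field fls \<Rightarrow> 'v \<Rightarrow> 'v::ab_group_add) \<Rightarrow> (nat \<Rightarrow> 'v) \<Rightarrow> 'v \<Rightarrow> bool" where
  "adic_limit scale X w \<longleftrightarrow>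
     (\<forall>L. is_lattice scale L \<longrightarrow> (\<forall>\<^sub>F n in sequentially. X n - w \<in> L))"

definition z_nabla :: "('a::field, 'v::ab_group_add) conn \<Rightarrow> 'v \<Rightarrow> 'v" where
  "z_nabla E v = conn_scale E fls_X_inv (conn_nabla E v)"

definition theta :: "('a::field, 'v::ab_group_add) conn \<Rightarrow> 'v \<Rightarrow> 'v" where
  "theta E v = - inv (z_nabla E) v"

definition theta_powi :: "('a::field, 'v::ab_group_add) conn \<Rightarrow> int \<Rightarrow> 'v \<Rightarrow> 'v" where
  "theta_powi E n = (if n \<ge> 0 then theta E ^^ nat n else inv (theta E) ^^ nat (- n))"

text \<open>The continuous extension of \<open>\<theta>\<close> to an action of \<open>k((\<theta>))\<close>: the series
  \<open>\<Sum>\<^sub>n h\<^sub>n \<theta>\<^sup>n\<close> acts by \<open>v \<mapsto> \<Sum>\<^sub>n h\<^sub>n \<theta>\<^sup>n(v)\<close>, the sum being taken in the \<open>\<zeta>\<close>-adic topology.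
  As the limit is taken by a definite description, \<open>theta_scale\<close> and \<open>mellin\<close> are meaningful
  only if \<open>z\<nabla>\<close> is invertible and these series converge, as they do when all slopes are \<open>> 0\<close>.\<close>

definition theta_scale ::
  "('a::field, 'v::ab_group_add) conn \<Rightarrow> 'a fls \<Rightarrow> 'v \<Rightarrow> 'v" where
  "theta_scale E h v = (THE w. adic_limit (conn_scale E)
     (\<lambda>N. \<Sum>n = fls_subdegree h..int N.
        conn_scale E (fls_const (fls_nth h n)) (theta_powi E n v)) w)"

definition mellin :: "('a::field, 'v::ab_group_add) conn \<Rightarrow> ('a, 'v) diff_mod" where
  "mellin E = \<lparr>dm_scale = theta_scale E, dm_Phi = conn_scale E fls_X_inv\<rparr>"

text \<open>The system \<open>f = - \<theta>\<^sup>-\<^sup>1\<close>, \<open>g = z - (-a)\<^sup>-\<^sup>r\<^sup>/\<^sup>s ((r+s)/2s) \<theta>\<^sup>1\<^sup>-\<^sup>r\<^sup>/\<^sup>s\<close> in the uniformizer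
  \<open>\<theta>\<^sup>1\<^sup>/\<^sup>s\<close>. Here \<open>t\<close> is \<open>\<zeta>\<^sup>1\<^sup>/\<^sup>r\<close> as a series in \<open>\<theta>\<^sup>1\<^sup>/\<^sup>s\<close>, so that \<open>z = t\<^sup>-\<^sup>r\<close> and \<open>f\<close>, a series in
  \<open>\<zeta>\<^sup>1\<^sup>/\<^sup>r\<close>, becomes \<open>f(t)\<close>; \<open>b\<close> is the root \<open>(-a)\<^sup>-\<^sup>r\<^sup>/\<^sup>s\<close> that is the leading coefficient of \<open>z\<close>.\<close>

definition mellin_system ::
  "nat \<Rightarrow> nat \<Rightarrow> 'a::field \<Rightarrow> 'a fls \<Rightarrow> 'a fls \<Rightarrow> bool" where
  "mellin_system s r a f g \<longleftrightarrow>
     (\<exists>t z b. fps_nth t 0 = 0 \<and> z * fps_to_fls t ^ r = 1 \<and>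
        fls_compose_fps f t = - (fls_X powi (- int s)) \<and>
        b ^ s = (- a) powi (- int r) \<and>
        z - fls_const b * fls_X powi (- int r) \<in> small_o (- int r) \<and>
        g = z - fls_const (b * (of_nat (r + s) / of_nat (2 * s))) * fls_X powi (int s - int r))"

end

theory Submission
  imports Defs
begin

text \<open>
  Write \<open>u = \<zeta>\<^sup>1\<^sup>/\<^sup>r\<close> and \<open>x = \<theta>\<^sup>1\<^sup>/\<^sup>s\<close>. On \<open>k((u))\<close> the operator \<open>\<theta>\<^sup>-\<^sup>1 = - z\<nabla>\<close> is \<open>- f + (1/r) u d/du\<close>. The first
  equation of the system is solved by a uniformizer \<open>t\<close> with \<open>f(t(x)) = - x\<^sup>-\<^sup>s\<close>, and the substitution
  \<open>u = t(x)\<close> identifies \<open>k((u))\<close> with \<open>k((x))\<close> and turns \<open>\<theta>\<^sup>-\<^sup>1\<close> into \<open>D = x\<^sup>-\<^sup>s + q(x) x d/dx\<close>, where \<open>q(0) = 1/r\<close>,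
  and \<open>\<Phi>\<close> into multiplication by \<open>z = t\<^sup>-\<^sup>r\<close>. So \<open>\<theta>\<close> is already \<open>x\<^sup>s\<close> up to a derivative term of relative
  order \<open>s\<close>.

  That term is removed by an operator \<open>T x\<^sup>n = \<Sum>\<^sub>j c\<^sub>j(n) x\<^sup>n\<^sup>+\<^sup>j\<close> with \<open>T D = x\<^sup>-\<^sup>s T\<close> and \<open>T 1 = 1\<close>, whose coefficients
  \<open>c\<^sub>j\<close> are polynomials. The condition is a recursive system of difference equations
  \<open>c\<^sub>j(n) - c\<^sub>j(n - s) = \<dots>\<close>, and every such equation has a polynomial solution, unique up to a constant
  (\<open>straighten_euler_op\<close>). Uniqueness is what makes the polynomials useful: \<open>T z T\<^sup>-\<^sup>1\<close> and \<open>\<phi>\<close> have the same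
  commutation relation with \<open>x\<^sup>-\<^sup>s\<close> and polynomial coefficients, so they differ by multiplication with a
  series, which must be \<open>g' = T z\<close> (\<open>straighten_intertwines\<close>). Thus the transform of \<open>E\<^sub>f\<close> is
  \<open>(k((x)), g' \<phi>)\<close>. Its isomorphism class depends only on the class of \<open>g'\<close>, in which just the terms
  of relative order at most \<open>s\<close> are visible (\<open>phi_ext_eigenvector_ex\<close>).
  In that range only \<open>c\<^sub>s(n) = n (n + s) / (2rs)\<close> contributes, and \<open>n = - r\<close> gives
  \<open>g' = z (1 - (s - r)/(2s) x\<^sup>s + \<dots>)\<close>. The formula of the theorem has \<open>(r + s)/(2s)\<close> instead; the two differ by
  \<open>r/s \<in> \<int>/s\<close>, hence by a quotient \<open>\<phi>(y)/y\<close> (\<open>mellin_intertwiner_ex\<close>).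

  The resulting bijection \<open>\<Psi>\<close> shifts orders of vanishing by a constant, so it is compatible with the limits
  that define the action of \<open>k((\<theta>))\<close>, once the lattices are seen to define the topology of the order of
  vanishing (\<open>mellin_iso_D_obj\<close>).

  Finally, all solutions \<open>t\<close> arise from one of them by \<open>x \<mapsto> \<omega> x\<close> with \<open>\<omega>\<^sup>s = 1\<close>
  (\<open>substitution_solutions\<close>), so the class of \<open>g\<close> is well defined. That it lies in \<open>S\<^sup>\<circ>\<close> follows from \<open>f \<in> R\<^sup>\<circ>\<close>: a
  symmetry \<open>x \<mapsto> \<epsilon> x\<close> of the class of \<open>g\<close> is one of \<open>z\<close> up to relative order \<open>s\<close>, and then \<open>u \<mapsto> \<epsilon> u\<close> is a
  symmetry of the polar part of \<open>f\<close> (\<open>galois_invariance_of_f\<close>).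
\<close>

section \<open>Orders of Laurent series\<close>

definition order_ge :: "int \<Rightarrow> 'a::zero fls set" where
  "order_ge N = {v. \<forall>n<N. fls_nth v n = 0}"

lemma order_geI: "(\<And>n. n < N \<Longrightarrow> fls_nth v n = 0) \<Longrightarrow> v \<in> order_ge N"
  by (simp add: order_ge_def)

lemma order_geD: "v \<in> order_ge N \<Longrightarrow> n < N \<Longrightarrow> fls_nth v n = 0"
  by (simp add: order_ge_def)

lemma small_o_eq_order_ge: "small_o k = order_ge (k + 1)"
  by (simp add: small_o_def order_ge_def zle_add1_eq_le)

lemma order_ge_zero [simp]: "0 \<in> order_ge N"
  by (simp add: order_ge_def)

lemma order_ge_mono: "v \<in> order_ge N \<Longrightarrow> M \<le> N \<Longrightarrow> v \<in> order_ge M"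
  by (simp add: order_ge_def)

lemma order_ge_add: "u \<in> order_ge N \<Longrightarrow> v \<in> order_ge N \<Longrightarrow> u + v \<in> order_ge N"
  for u v :: "'a::comm_ring_1 fls"
  by (simp add: order_ge_def)

lemma order_ge_diff: "u \<in> order_ge N \<Longrightarrow> v \<in> order_ge N \<Longrightarrow> u - v \<in> order_ge N"
  for u v :: "'a::comm_ring_1 fls"
  by (simp add: order_ge_def)

lemma order_ge_uminus_iff [simp]: "- v \<in> order_ge N \<longleftrightarrow> v \<in> order_ge N"
  for v :: "'a::comm_ring_1 fls"
  by (simp add: order_ge_def)

lemma order_ge_sum: "(\<And>i. i \<in> I \<Longrightarrow> v i \<in> order_ge N) \<Longrightarrow> (\<Sum>i\<in>I. v i) \<in> order_ge N"
  for v :: "'b \<Rightarrow> 'a::comm_ring_1 fls"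
  by (induction I rule: infinite_finite_induct) (simp_all add: order_ge_add)

lemma order_ge_subdegree_iff: "v \<in> order_ge N \<longleftrightarrow> v = 0 \<or> N \<le> fls_subdegree v"
proof
  assume "v \<in> order_ge N"
  then show "v = 0 \<or> N \<le> fls_subdegree v"
    using fls_subdegree_geI[of v N] by (auto simp: order_ge_def)
qed (auto simp: order_ge_def)

lemma in_order_ge_subdegree [simp]: "v \<in> order_ge (fls_subdegree v)"
  by (simp add: order_ge_subdegree_iff)

lemma order_ge_eq_0: "(\<And>N. v \<in> order_ge N) \<Longrightarrow> v = 0"
  by (rule fls_zero_eqI, rule order_geD[where N = "_ + 1"]) auto

lemma order_ge_mult:
  fixes u v :: "'a::field fls"
  assumes "u \<in> order_ge M" "v \<in> order_ge N"
  shows "u * v \<in> order_ge (M + N)"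
  using assms order_geI[OF fls_times_nth_eq0, of "M + N" u v]
  by (cases "u = 0 \<or> v = 0") (auto simp: order_ge_subdegree_iff)

lemma shift_1_times: "fls_shift m 1 * v = fls_shift m v"
  for v :: "'a::field fls"
  using fls_X_intpow_times_conv_shift(1)[of "- m" v] by simp

lemma times_shift_1: "v * fls_shift m 1 = fls_shift m v"
  for v :: "'a::field fls"
  by (simp add: mult.commute[of v] shift_1_times)

lemma order_ge_shift_iff [simp]: "fls_shift m v \<in> order_ge N \<longleftrightarrow> v \<in> order_ge (N + m)"
proof
  assume v: "fls_shift m v \<in> order_ge N"
  show "v \<in> order_ge (N + m)"
    by (rule order_geI) (use order_geD[OF v, of "_ - m"] in simp)
qed (simp add: order_ge_def)

lemma order_ge_mult_intpow_iff [simp]: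
  fixes v :: "'a::field fls"
  shows "fls_X_intpow n * v \<in> order_ge N \<longleftrightarrow> v \<in> order_ge (N - n)"
  by (simp add: shift_1_times)

lemma one_in_order_ge [simp]: "1 \<in> (order_ge N :: 'a::field fls set) \<longleftrightarrow> N \<le> 0"
  by (simp add: order_ge_subdegree_iff)

lemma order_ge_fps_to_fls [simp]: "fps_to_fls p \<in> order_ge 0"
  by (simp add: order_ge_def)

lemma order_ge_const_mult: "v \<in> order_ge N \<Longrightarrow> fls_const c * v \<in> order_ge N"
  for v :: "'a::comm_ring_1 fls"
  by (simp add: order_ge_def)

lemma order_ge_leading_term:
  fixes v :: "'a::field fls"
  assumes "v \<in> order_ge N"
  shows "v - fls_const (fls_nth v N) * fls_X_intpow N \<in> order_ge (N + 1)"
  using assms by (auto simp: order_ge_def)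

lemma order_ge_Suc_iff: "v \<in> order_ge (N + 1) \<longleftrightarrow> v \<in> order_ge N \<and> fls_nth v N = 0"
proof -
  have "n < N + 1 \<longleftrightarrow> n < N \<or> n = N" for n by linarith
  then show ?thesis by (auto simp: order_ge_def)
qed

lemma fls_nth_mult_leading:
  fixes u v :: "'a::field fls"
  assumes u: "u \<in> order_ge M" and v: "v \<in> order_ge N"
  shows "fls_nth (u * v) (M + N) = fls_nth u M * fls_nth v N"
proof -
  define a b where "a = u - fls_const (fls_nth u M) * fls_X_intpow M"
    and "b = v - fls_const (fls_nth v N) * fls_X_intpow N"
  have a: "a \<in> order_ge (M + 1)" and b: "b \<in> order_ge (N + 1)"
    using order_ge_leading_term u v by (auto simp: a_def b_def)
  have "u * v = a * v + fls_const (fls_nth u M) * (fls_X_intpow M * b) 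
     + fls_const (fls_nth u M * fls_nth v N) * (fls_X_intpow M * fls_X_intpow N)"
    by (simp add: a_def b_def algebra_simps flip: fls_const_mult_const)
  moreover have "fls_nth (a * v) (M + N) = 0"
    using order_ge_mult[OF a v] by (rule order_geD) simp
  moreover have "fls_nth (fls_X_intpow M * b) (M + N) = 0"
    by (rule order_geD[where N = "M + N + 1"]) (use b in \<open>simp_all add: add.commute\<close>)
  moreover have "fls_nth (fls_X_intpow M * fls_X_intpow N :: 'a fls) (M + N) = 1"
    by (simp add: fls_X_intpow_times_conv_shift)
  ultimately show ?thesis by simp
qed

section \<open>Filtered operators\<close>

text \<open>The order condition makes such an operator continuous, so its values on monomials determine it.\<close>

definition filtered_op :: "int \<Rightarrow> ('a::field fls \<Rightarrow> 'a fls) \<Rightarrow> bool" where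
  "filtered_op d P \<longleftrightarrow> (\<forall>u v. P (u + v) = P u + P v) \<and>
     (\<forall>c v. P (fls_const c * v) = fls_const c * P v) \<and>
     (\<forall>N. \<forall>v \<in> order_ge N. P v \<in> order_ge (N + d))"

lemma
  assumes "filtered_op d P"
  shows filtered_add: "P (u + v) = P u + P v"
    and filtered_scale: "P (fls_const c * v) = fls_const c * P v"
    and filtered_order: "v \<in> order_ge N \<Longrightarrow> P v \<in> order_ge (N + d)"
  using assms by (auto simp: filtered_op_def)

lemma filtered_zero: "filtered_op d P \<Longrightarrow> P 0 = 0"
  using filtered_scale[of d P 0 0] by simp

lemma filtered_uminus: "filtered_op d P \<Longrightarrow> P (- v) = - P v"
  using filtered_scale[of d P "-1" v] by (simp add: fls_const_uminus)

lemma filtered_diff: "filtered_op d P \<Longrightarrow> P (u - v) = P u - P v"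
  using filtered_add[of d P u "- v"] by (simp add: filtered_uminus)

lemma filtered_sum: "filtered_op d P \<Longrightarrow> P (\<Sum>i\<in>I. v i) = (\<Sum>i\<in>I. P (v i))"
  by (induction I rule: infinite_finite_induct) (simp_all add: filtered_zero filtered_add)

lemma filtered_op_mono: "filtered_op d P \<Longrightarrow> e \<le> d \<Longrightarrow> filtered_op e P"
  unfolding filtered_op_def by (meson add_left_mono order_ge_mono)

lemma filtered_op_comp:
  assumes "filtered_op d P" "filtered_op e Q"
  shows "filtered_op (d + e) (\<lambda>v. P (Q v))"
proof -
  have "P (Q v) \<in> order_ge (N + (d + e))" if "v \<in> order_ge N" for v N
    using filtered_order[OF assms(1) filtered_order[OF assms(2) that]] by (simp add: ac_simps)
  then show ?thesis using assms by (simp add: filtered_op_def)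
qed

lemma filtered_op_diff:
  "filtered_op d P \<Longrightarrow> filtered_op d Q \<Longrightarrow> filtered_op d (\<lambda>v. P v - Q v)"
  unfolding filtered_op_def by (auto simp: order_ge_diff algebra_simps)

lemma filtered_op_add:
  "filtered_op d P \<Longrightarrow> filtered_op d Q \<Longrightarrow> filtered_op d (\<lambda>v. P v + Q v)"
  unfolding filtered_op_def by (auto simp: order_ge_add algebra_simps)

lemma filtered_op_mult: "w \<in> order_ge d \<Longrightarrow> filtered_op d (\<lambda>v. w * v)"
  unfolding filtered_op_def by (auto simp: algebra_simps dest: order_ge_mult)

text \<open>The order gained by a filtered operator can be read off from its values on monomials:
  peel off leading terms until the original filtration takes over.\<close>

lemma filtered_op_improve:
  assumes P: "filtered_op d P" and mon: "\<And>n. P (fls_X_intpow n) \<in> order_ge (n + e)"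
  shows "filtered_op e P"
proof -
  have "P v \<in> order_ge (N + e)" if v: "v \<in> order_ge N" for N v
  proof -
    have ex: "\<exists>w \<in> order_ge (N + int j). P v - P w \<in> order_ge (N + e)" for j
    proof (induction j)
      case 0
      then show ?case using v by (intro bexI[of _ v]) auto
    next
      case (Suc j)
      then obtain w where w: "w \<in> order_ge (N + int j)" "P v - P w \<in> order_ge (N + e)" by blast
      define m where "m = fls_const (fls_nth w (N + int j)) * fls_X_intpow (N + int j)"
      have "w - m \<in> order_ge (N + int (Suc j))"
        using order_ge_leading_term[OF w(1)] by (simp add: m_def algebra_simps)
      moreover have "P m \<in> order_ge (N + e)"
        unfolding m_def filtered_scale[OF P]
        by (intro order_ge_const_mult order_ge_mono[OF mon]) simp
      then have "P v - P (w - m) \<in> order_ge (N + e)"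
        using order_ge_add[OF w(2)] by (simp add: filtered_diff[OF P] algebra_simps)
      ultimately show ?case by blast
    qed
    obtain w where w: "w \<in> order_ge (N + int (nat (e - d)))" "P v - P w \<in> order_ge (N + e)"
      using ex by blast
    have "P w \<in> order_ge (N + e)"
      using filtered_order[OF P w(1)] by (rule order_ge_mono) simp
    then show ?thesis using order_ge_add[OF w(2)] by fastforce
  qed
  then show ?thesis using P by (simp add: filtered_op_def)
qed

lemma filtered_op_eq_0:
  assumes P: "filtered_op d P" and "\<And>n. P (fls_X_intpow n) = 0"
  shows "P v = 0"
proof (rule order_ge_eq_0)
  fix N
  have "filtered_op (N - fls_subdegree v) P"
    by (rule filtered_op_improve[OF P]) (simp add: assms)
  from filtered_order[OF this in_order_ge_subdegree[of v]] show "P v \<in> order_ge N" by simp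
qed

lemma filtered_leading:
  assumes P: "filtered_op d P" and v: "v \<in> order_ge N"
  shows "fls_nth (P v) (N + d) = fls_nth v N * fls_nth (P (fls_X_intpow N)) (N + d)"
proof -
  define m where "m = fls_const (fls_nth v N) * fls_X_intpow N"
  have "P (v - m) \<in> order_ge (N + 1 + d)"
    using filtered_order[OF P order_ge_leading_term[OF v]] by (simp add: m_def)
  then have "fls_nth (P (v - m)) (N + d) = 0" by (rule order_geD) simp
  then show ?thesis by (simp add: filtered_diff[OF P] m_def filtered_scale[OF P])
qed

text \<open>If no leading coefficient vanishes from order \<open>N\<close> on, a preimage is found by successive
  approximation.\<close>

lemma filtered_op_surj:
  assumes P: "filtered_op d P"
    and lead: "\<And>n. N \<le> n \<Longrightarrow> fls_nth (P (fls_X_intpow n)) (n + d) \<noteq> 0"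
    and w: "w \<in> order_ge (N + d)"
  shows "\<exists>v \<in> order_ge N. P v = w"
proof -
  \<comment> \<open>The correction is chosen to cancel the coefficient of the error at \<open>N + k + d\<close>.\<close>
  define step where "step k v = v + fls_const (fls_nth (w - P v) (N + int k + d) / 
     fls_nth (P (fls_X_intpow (N + int k))) (N + int k + d)) * fls_X_intpow (N + int k)" for k v
  define V where "V = rec_nat 0 step"
  have V0: "V 0 = 0" and VS: "V (Suc k) = step k (V k)" for k by (simp_all add: V_def)
  have err: "w - P (V k) \<in> order_ge (N + int k + d)" for k
  proof (induction k)
    case 0
    then show ?case using w by (simp add: V0 filtered_zero[OF P])
  next
    case (Suc k)
    let ?l = "fls_nth (P (fls_X_intpow (N + int k))) (N + int k + d)"
    let ?e = "w - P (V k)"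
    have eq: "w - P (V (Suc k)) = ?e - fls_const (fls_nth ?e (N + int k + d) / ?l) * 
       P (fls_X_intpow (N + int k))"
      unfolding VS step_def filtered_add[OF P] filtered_scale[OF P] by (rule diff_diff_add[symmetric])
    have "P (fls_X_intpow (N + int k)) \<in> order_ge (N + int k + d)"
      by (rule filtered_order[OF P]) simp
    with Suc have "w - P (V (Suc k)) \<in> order_ge (N + int k + d)"
      unfolding eq by (metis order_ge_diff order_ge_const_mult)
    moreover have "fls_nth (w - P (V (Suc k))) (N + int k + d) = 0"
      unfolding eq using lead[of "N + int k"] by simp
    ultimately have "w - P (V (Suc k)) \<in> order_ge (N + int k + d + 1)"
      by (simp only: order_ge_Suc_iff simp_thms)
    then show ?case by (simp only: of_nat_Suc ac_simps)
  qed
  have V_stable: "fls_nth (V (k + j)) n = fls_nth (V k) n" if "n < N + int k" for k j n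
    using that by (induction j) (simp_all add: VS step_def)
  have V_ge: "V k \<in> order_ge N" for k
    by (rule order_geI) (use V_stable[of _ 0 k] in \<open>simp add: V0\<close>)
  define v where "v = Abs_fls (\<lambda>n. fls_nth (V (nat (n - N) + 1)) n)"
  have v_nth: "fls_nth v n = fls_nth (V (nat (n - N) + 1)) n" for n
    unfolding v_def
    by (rule nth_Abs_fls_lower_bound[of N]) (use V_ge in \<open>auto intro: order_geD\<close>)
  have v_V: "v - V k \<in> order_ge (N + int k)" for k
  proof (rule order_geI)
    fix n assume n: "n < N + int k"
    show "fls_nth (v - V k) n = 0"
    proof (cases "n < N")
      case True
      then show ?thesis using V_ge[THEN order_geD, OF True] by (simp add: v_nth)
    next
      case False
      with n have "nat (n - N) + 1 \<le> k" by linarith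
      then obtain j where "k = nat (n - N) + 1 + j" using le_Suc_ex by blast
      then show ?thesis using V_stable[of n "nat (n - N) + 1" j] False by (simp add: v_nth)
    qed
  qed
  have "w - P v = 0"
  proof (rule order_ge_eq_0)
    fix M
    define k where "k = nat (M - N - d)"
    have "w - P (V k) - P (v - V k) \<in> order_ge (N + int k + d)"
      by (intro order_ge_diff err filtered_order[OF P v_V])
    then have "w - P v \<in> order_ge (N + int k + d)" by (simp add: filtered_diff[OF P])
    then show "w - P v \<in> order_ge M" by (rule order_ge_mono) (simp add: k_def)
  qed
  moreover have "v \<in> order_ge N"
    using v_V[of 0] by (simp add: V0)
  ultimately show ?thesis by auto
qed

text \<open>No later term can cancel the leading term of \<open>v\<close>, so \<open>P\<close> shifts the order by exactly \<open>d\<close>; this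
  gives injectivity, and successive approximation gives surjectivity.\<close>

lemma
  assumes P: "filtered_op d P"
    and lead: "\<And>n. fls_nth (P (fls_X_intpow n)) (n + d) \<noteq> 0"
  shows filtered_order_iff: "P v \<in> order_ge (N + d) \<longleftrightarrow> v \<in> order_ge N"
    and filtered_bij: "bij P"
proof -
  have iff: "P v \<in> order_ge (N + d) \<longleftrightarrow> v \<in> order_ge N" for v N
  proof
    assume Pv: "P v \<in> order_ge (N + d)"
    show "v \<in> order_ge N"
    proof (cases "v = 0")
      case False
      let ?n = "fls_subdegree v"
      have "fls_nth (P v) (?n + d) = fls_nth v ?n * fls_nth (P (fls_X_intpow ?n)) (?n + d)"
        by (rule filtered_leading[OF P]) simp
      then have "fls_nth (P v) (?n + d) \<noteq> 0" using False lead by simp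
      then have "\<not> ?n + d < N + d" using Pv order_geD by blast
      then show ?thesis by (simp add: order_ge_subdegree_iff)
    qed auto
  qed (rule filtered_order[OF P])
  then show "P v \<in> order_ge (N + d) \<longleftrightarrow> v \<in> order_ge N" .
  have "u = v" if "P u = P v" for u v
  proof -
    have "u - v = 0"
      by (rule order_ge_eq_0, subst iff[symmetric]) (simp add: filtered_diff[OF P] that)
    then show ?thesis by simp
  qed
  moreover have "\<exists>v. P v = w" for w
    using filtered_op_surj[OF P lead, where N = "fls_subdegree w - d" and w = w] by auto
  ultimately show "bij P" by (metis bijI injI surjI)
qed

section \<open>Operators with polynomial coefficients\<close>

text \<open>Polynomial dependence on \<open>n\<close> is what distinguishes the operators below from arbitrary filtered
  ones: multiplication by a series, the derivation, and the difference operator all have it, and it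
  makes solutions of difference equations in \<open>n\<close> unique up to a constant.\<close>

definition poly_coeffs :: "('a::field_char_0 fls \<Rightarrow> 'a fls) \<Rightarrow> bool" where
  "poly_coeffs P \<longleftrightarrow>
     (\<forall>k. \<exists>p. \<forall>n. fls_nth (P (fls_X_intpow n)) (n + k) = poly p (of_int n))"

lemma poly_coeffs_mult: "poly_coeffs (\<lambda>v. w * v)"
  unfolding poly_coeffs_def
proof
  fix k
  show "\<exists>p. \<forall>n. fls_nth (w * fls_X_intpow n) (n + k) = poly p (of_int n)"
    by (rule exI[of _ "[:fls_nth w k:]"]) (simp add: fls_X_intpow_times_conv_shift)
qed

lemma poly_coeffs_diff:
  assumes "poly_coeffs P" "poly_coeffs Q"
  shows "poly_coeffs (\<lambda>v. P v - Q v)"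
  unfolding poly_coeffs_def
proof
  fix k
  obtain p q where
    "\<forall>n. fls_nth (P (fls_X_intpow n)) (n + k) = poly p (of_int n)"
    "\<forall>n. fls_nth (Q (fls_X_intpow n)) (n + k) = poly q (of_int n)"
    using assms by (meson poly_coeffs_def)
  then show "\<exists>p. \<forall>n. fls_nth (P (fls_X_intpow n) - Q (fls_X_intpow n)) (n + k) = poly p (of_int n)"
    by (intro exI[of _ "p - q"]) simp
qed

lemma order_ge_truncate:
  fixes v :: "'a::field fls"
  assumes "v \<in> order_ge N"
  shows "v - (\<Sum>i<k. fls_const (fls_nth v (N + int i)) * fls_X_intpow (N + int i)) 
    \<in> order_ge (N + int k)" (is "v - ?s k \<in> _")
proof (induction k)
  case 0
  then show ?case using assms by simp
next
  case (Suc k)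
  have "fls_nth (?s k) (N + int k) = 0"
    by (simp add: fls_nth_sum)
  then have "v - ?s k - fls_const (fls_nth v (N + int k)) * fls_X_intpow (N + int k) 
     \<in> order_ge (N + int k + 1)"
    using order_ge_leading_term[OF Suc] by simp
  then show ?case by (simp add: algebra_simps)
qed

text \<open>Each coefficient of a composition is a finite sum, because both operators are bounded below in
  order; shifting the argument of a polynomial leaves it a polynomial.\<close>

lemma poly_coeffs_comp:
  assumes P: "filtered_op d P" "poly_coeffs P" and Q: "filtered_op e Q" "poly_coeffs Q"
  shows "poly_coeffs (\<lambda>v. P (Q v))"
  unfolding poly_coeffs_def
proof
  fix k
  obtain p where p: "fls_nth (P (fls_X_intpow n)) (n + j) = poly (p j) (of_int n)" for j n
    using P(2) by (auto simp: poly_coeffs_def) metis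
  obtain q where q: "fls_nth (Q (fls_X_intpow n)) (n + j) = poly (q j) (of_int n)" for j n
    using Q(2) by (auto simp: poly_coeffs_def) metis
  \<comment> \<open>From the \<open>K\<close>-th term of \<open>Q(x\<^sup>n)\<close> on, \<open>P\<close> no longer contributes at exponent \<open>n + k\<close>.\<close>
  define K where "K = nat (k - d - e) + 1"
  define r where "r = (\<Sum>i<K. q (e + int i) * pcompose (p (k - e - int i)) [:of_int (e + int i), 1:])"
  have "fls_nth (P (Q (fls_X_intpow n))) (n + k) = poly r (of_int n)" for n
  proof -
    let ?v = "Q (fls_X_intpow n)"
    let ?s = "\<Sum>i<K. fls_const (fls_nth ?v (n + e + int i)) * fls_X_intpow (n + e + int i)"
    have "?v \<in> order_ge (n + e)" by (rule filtered_order[OF Q(1)]) simp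
    then have "P (?v - ?s) \<in> order_ge (n + e + int K + d)"
      by (intro filtered_order[OF P(1)] order_ge_truncate)
    then have "fls_nth (P (?v - ?s)) (n + k) = 0"
      by (rule order_geD) (simp add: K_def)
    then have "fls_nth (P ?v - P ?s) (n + k) = 0"
      by (simp only: filtered_diff[OF P(1)])
    moreover have "fls_nth (P ?s) (n + k) = poly r (of_int n)"
    proof -
      have "fls_nth (P (fls_X_intpow (n + e + int i))) (n + k) = 
          poly (p (k - e - int i)) (of_int (n + (e + int i)))" for i
        using p[of "n + (e + int i)" "k - e - int i"] by (simp add: algebra_simps)
      moreover have "fls_nth ?v (n + e + int i) = poly (q (e + int i)) (of_int n)" for i
        using q[of n "e + int i"] by (simp add: algebra_simps)
      ultimately show ?thesis
        by (simp add: filtered_sum[OF P(1)] filtered_scale[OF P(1)] fls_nth_sum r_def poly_sum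
            poly_pcompose algebra_simps del: fls_X_intpow_times_conv_shift)
    qed
    ultimately show ?thesis by simp
  qed
  then show "\<exists>p. \<forall>n. fls_nth (P (Q (fls_X_intpow n))) (n + k) = poly p (of_int n)" by blast
qed

text \<open>A nonconstant polynomial takes no value infinitely often, so a periodic one is constant.\<close>

lemma poly_periodic_eq_0:
  fixes p :: "'a::field_char_0 poly"
  assumes s: "s > 0" and per: "\<And>n::int. poly p (of_int (n - int s)) = poly p (of_int n)"
    and 0: "poly p 0 = 0"
  shows "p = 0"
proof (rule ccontr)
  assume "p \<noteq> 0"
  have "poly p (of_int (- int s * int k)) = 0" for k
  proof (induction k)
    case (Suc k)
    have "- int s * int (Suc k) = - int s * int k - int s" by (simp add: algebra_simps)
    then show ?case using Suc per[of "- int s * int k"] by metis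
  qed (simp add: 0)
  then have "range (\<lambda>k. of_int (- int s * int k)) \<subseteq> {x. poly p x = 0}" by auto
  moreover have "inj (\<lambda>k. of_int (- int s * int k) :: 'a)"
    using s by (auto simp: inj_def simp flip: of_int_mult of_int_minus)
  ultimately show False
    using poly_roots_finite[OF \<open>p \<noteq> 0\<close>] range_inj_infinite finite_subset by blast
qed

text \<open>The polynomial difference equation: the term \<open>x\<^sup>d\<^sup>+\<^sup>1 / (d + 1) s\<close> accounts for the leading
  term of a right-hand side of degree \<open>d\<close>.\<close>

lemma poly_difference_equation_ex:
  fixes p :: "'a::field_char_0 poly"
  assumes s: "s > 0"
  shows "\<exists>P. poly P 0 = 0 \<and> P - pcompose P [:- of_nat s, 1:] = p"
proof (induction "degree p" arbitrary: p rule: less_induct)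
  case less
  show ?case
  proof (cases "p = 0")
    case True
    then show ?thesis by (intro exI[of _ 0]) simp
  next
    case False
    define d where "d = degree p"
    define c where "c = lead_coeff p / (of_nat (Suc d) * of_nat s)"
    define P where "P = monom c (Suc d)"
    define D where "D = P - pcompose P [:- of_nat s, 1:]"
    have "pcompose ([:0, 1:] ^ k) r = r ^ k" for k and r :: "'a poly"
      by (induction k) (simp_all add: pcompose_mult pcompose_pCons pcompose_1)
    then have D: "D = smult c (monom 1 (Suc d) - [:- of_nat s, 1:] ^ Suc d)"
      by (simp add: D_def P_def monom_altdef pcompose_smult smult_diff_right
          del: power_Suc)
    have coeff_D: "coeff D i = c * ((if i = Suc d then 1 else 0) - 
        of_nat (Suc d choose i) * (- of_nat s) ^ (Suc d - i))" if "i \<le> Suc d" for i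
      unfolding D coeff_smult coeff_diff coeff_monom
      using coeff_linear_poly_power[OF that, of "- of_nat s :: 'a" 1] by simp
    have top: "coeff D (Suc d) = 0" using coeff_D[of "Suc d"] by simp
    have "coeff D d = c * (of_nat (Suc d) * of_nat s)" using coeff_D[of d] by simp
    moreover have "(of_nat (Suc d) * of_nat s :: 'a) \<noteq> 0" using s by (simp del: of_nat_Suc)
    ultimately have d: "coeff D d = lead_coeff p" unfolding c_def by (metis nonzero_eq_divide_eq)
    have "degree D \<le> Suc d"
      unfolding D by (intro order.trans[OF degree_smult_le] degree_diff_le degree_monom_le) 
       (simp add: degree_power_eq del: power_Suc)
    then have degD: "degree D \<le> d"
      using top by (metis le_SucE leading_coeff_0_iff degree_0 le0)
    show ?thesis
    proof (cases "d = 0")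
      case True
      then have "D = p" using d degD by (metis d_def degree_eq_zeroE le_zero_eq pCons_0_0 coeff_pCons_0)
      then show ?thesis
        by (intro exI[of _ P]) (auto simp: D_def P_def poly_monom)
    next
      case False
      have "degree (p - D) < degree p"
      proof (rule degree_lessI)
        show "p - D \<noteq> 0 \<or> 0 < degree p" using False d_def by simp
        show "\<forall>k\<ge>degree p. coeff (p - D) k = 0"
        proof (intro allI impI)
          fix k assume "k \<ge> degree p"
          then consider "k = d" | "k > d" by (auto simp: d_def nat_less_le)
          then show "coeff (p - D) k = 0"
          proof cases
            case 1
            then show ?thesis using d by (simp add: d_def)
          next
            case 2
            then show ?thesis using degD by (simp add: d_def coeff_eq_0)
          qed
        qed
      qed
      from less[OF this] obtain R where R: "poly R 0 = 0" "R - pcompose R [:- of_nat s, 1:] = p - D"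
        by blast
      have "(P + R) - pcompose (P + R) [:- of_nat s, 1:] = D + (R - pcompose R [:- of_nat s, 1:])"
        by (simp add: D_def pcompose_add)
      then have "(P + R) - pcompose (P + R) [:- of_nat s, 1:] = p" unfolding R(2) by simp
      moreover have "poly (P + R) 0 = 0" using R(1) by (simp add: P_def poly_monom)
      ultimately show ?thesis by blast
    qed
  qed
qed

definition antidifference :: "nat \<Rightarrow> 'a::field_char_0 poly \<Rightarrow> 'a poly" where
  "antidifference s p = (SOME P. poly P 0 = 0 \<and> P - pcompose P [:- of_nat s, 1:] = p)"

lemma
  assumes "s > 0"
  shows antidifference_0: "poly (antidifference s p) 0 = 0"
    and antidifference: "antidifference s p - pcompose (antidifference s p) [:- of_nat s, 1:] = p"
  using someI_ex[OF poly_difference_equation_ex[OF assms, of p]] by (auto simp: antidifference_def)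

lemma antidifference_unique:
  assumes s: "s > 0" and P: "poly P 0 = 0" "P - pcompose P [:- of_nat s, 1:] = p"
  shows "antidifference s p = P"
proof -
  let ?Q = "antidifference s p - P"
  have "?Q - pcompose ?Q [:- of_nat s, 1:] = 0"
  proof -
    have "?Q - pcompose ?Q [:- of_nat s, 1:] = (antidifference s p - 
        pcompose (antidifference s p) [:- of_nat s, 1:]) - (P - pcompose P [:- of_nat s, 1:])"
      by (simp add: pcompose_diff)
    then show ?thesis unfolding antidifference[OF s] P(2) by simp
  qed
  then have "poly ?Q x = poly (pcompose ?Q [:- of_nat s, 1:]) x" for x by simp
  then have "poly ?Q (of_int n) = poly ?Q (of_int (n - int s))" for n
    by (simp only: poly_pcompose) (simp add: algebra_simps)
  then have "?Q = 0"
    using poly_periodic_eq_0[OF s, of ?Q] antidifference_0[OF s, of p] P(1) by auto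
  then show ?thesis by simp
qed

section \<open>Straightening a first-order operator\<close>

text \<open>After the substitution \<open>u = t(x)\<close> with \<open>f(t(x)) = - x\<^sup>-\<^sup>s\<close>, the operator \<open>\<theta>\<^sup>-\<^sup>1 = - z\<nabla>\<close> takes this
  form, with \<open>q = t / (r x t')\<close>.\<close>

definition euler_op :: "nat \<Rightarrow> 'a::field_char_0 fps \<Rightarrow> 'a fls \<Rightarrow> 'a fls" where
  "euler_op s q v = fls_X_intpow (- int s) * v + fps_to_fls q * (fls_X * fls_deriv v)"

text \<open>Let \<open>T x\<^sup>n = \<Sum>\<^sub>j c\<^sub>j(n) x\<^sup>n\<^sup>+\<^sup>j\<close>. Comparing the coefficients of \<open>x\<^sup>n\<^sup>-\<^sup>s\<^sup>+\<^sup>j\<close> in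
  \<open>T (x\<^sup>-\<^sup>s + q x d/dx) x\<^sup>n = x\<^sup>-\<^sup>s T x\<^sup>n\<close> expresses \<open>c\<^sub>j(n) - c\<^sub>j(n - s)\<close> by the \<open>c\<^sub>l\<close> with \<open>l \<le> j - s\<close>.
  The antidifference is normalized to vanish at \<open>0\<close>, so that \<open>T 1 = 1\<close>.\<close>

function straighten_coeff :: "nat \<Rightarrow> 'a::field_char_0 fps \<Rightarrow> nat \<Rightarrow> 'a poly" where
  "straighten_coeff s q j = (if j = 0 \<or> s = 0 then 1 else antidifference s ([:0, 1:] *
     (\<Sum>l | l + s \<le> j. smult (fps_nth q (j - s - l))
        (pcompose (straighten_coeff s q l) [:of_nat (j - s - l), 1:]))))"
  by auto
termination by (relation "measure (\<lambda>(s, q, j). j)") auto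

declare straighten_coeff.simps [simp del]

lemma straighten_coeff_0 [simp]: "straighten_coeff s q 0 = 1"
  by (simp add: straighten_coeff.simps)

lemma straighten_coeff_normalized: "s > 0 \<Longrightarrow> j > 0 \<Longrightarrow> poly (straighten_coeff s q j) 0 = 0"
  by (simp add: straighten_coeff.simps[of s q j] antidifference_0)

lemma straighten_coeff_difference:
  fixes n :: int
  assumes s: "s > 0"
  shows "poly (straighten_coeff s q j) (of_int n) - poly (straighten_coeff s q j) (of_int (n - int s)) =
     of_int n * (\<Sum>l | l + s \<le> j. fps_nth q (j - s - l) * 
       poly (straighten_coeff s q l) (of_int (n + int (j - s - l))))"
proof (cases "j = 0")
  case True
  then show ?thesis using s by simp
next
  case False
  let ?c = "straighten_coeff s q"
  let ?p = "[:0, 1:] * (\<Sum>l | l + s \<le> j. smult (fps_nth q (j - s - l)) (pcompose (?c l) [:of_nat (j - s - l), 1:]))"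
  have eq: "?c j = antidifference s ?p" using False s by (subst straighten_coeff.simps) simp
  have "?c j - pcompose (?c j) [:- of_nat s, 1:] = ?p" unfolding eq by (rule antidifference[OF s])
  then have "poly (?c j - pcompose (?c j) [:- of_nat s, 1:]) (of_int n) = poly ?p (of_int n)" by simp
  then show ?thesis by (simp add: poly_sum poly_pcompose add.commute)
qed

lemma straighten_coeff_eq_0:
  assumes "0 < j" "j < s"
  shows "straighten_coeff s q j = 0"
proof -
  have none: "{l. l + s \<le> j} = {}" using assms by auto
  have "straighten_coeff s q j = antidifference s 0"
    using assms by (subst straighten_coeff.simps) (simp add: none)
  then show ?thesis using antidifference_unique[of s 0 0] assms by simp
qed

text \<open>The first correction: \<open>n (n + s) / 2s\<close> has the differences \<open>n\<close>.\<close>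

lemma straighten_coeff_first:
  assumes s: "s > 0"
  shows "poly (straighten_coeff s q s) x = fps_nth q 0 * x * (x + of_nat s) / (2 * of_nat s)"
proof -
  define P where "P = smult (fps_nth q 0 / (2 * of_nat s)) [:0, of_nat s, 1:]"
  have "{l. l + s \<le> s} = {0}" by auto
  then have "straighten_coeff s q s = antidifference s ([:0, 1:] * [:fps_nth q 0:])"
    using s by (subst straighten_coeff.simps) simp
  also have "\<dots> = P"
  proof (rule antidifference_unique[OF s])
    show "P - pcompose P [:- of_nat s, 1:] = [:0, 1:] * [:fps_nth q 0:]"
      using s by (simp add: P_def pcompose_smult pcompose_pCons field_simps)
  qed (simp add: P_def)
  finally show ?thesis by (simp add: P_def field_simps)
qed

text \<open>The continuous extension of \<open>x\<^sup>n \<mapsto> \<Sum>\<^sub>j c\<^sub>j(n) x\<^sup>n\<^sup>+\<^sup>j\<close>.\<close>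

definition op_of_coeffs :: "(nat \<Rightarrow> 'a poly) \<Rightarrow> 'a::field_char_0 fls \<Rightarrow> 'a fls" where
  "op_of_coeffs c v = Abs_fls (\<lambda>m. \<Sum>n = fls_subdegree v..m. poly (c (nat (m - n))) (of_int n) * fls_nth v n)"

lemma op_of_coeffs_nth:
  assumes "v \<in> order_ge N"
  shows "fls_nth (op_of_coeffs c v) m = (\<Sum>n = N..m. poly (c (nat (m - n))) (of_int n) * fls_nth v n)"
proof -
  have "fls_nth (op_of_coeffs c v) m = 
      (\<Sum>n = fls_subdegree v..m. poly (c (nat (m - n))) (of_int n) * fls_nth v n)"
    unfolding op_of_coeffs_def by (rule nth_Abs_fls_lower_bound[of "fls_subdegree v"]) simp
  also have "\<dots> = (\<Sum>n = N..m. poly (c (nat (m - n))) (of_int n) * fls_nth v n)"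
    using assms by (cases "v = 0")
      (auto simp: order_ge_subdegree_iff intro!: sum.mono_neutral_left)
  finally show ?thesis .
qed

lemma op_of_coeffs_intpow:
  "fls_nth (op_of_coeffs c (fls_X_intpow n)) (n + k) = (if k < 0 then 0 else poly (c (nat k)) (of_int n))"
proof -
  have "fls_nth (op_of_coeffs c (fls_X_intpow n)) (n + k) = 
     (\<Sum>i = n..n + k. if i = n then poly (c (nat k)) (of_int n) else 0)"
    by (subst op_of_coeffs_nth[where N = n]) (simp, intro sum.cong, auto)
  then show ?thesis by simp
qed

lemma op_of_coeffs_filtered: "filtered_op 0 (op_of_coeffs c)"
  unfolding filtered_op_def
proof (intro conjI allI ballI)
  fix u v :: "'a fls" and a :: 'a
  define N where "N = min (fls_subdegree u) (fls_subdegree v)"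
  have u: "u \<in> order_ge N" and v: "v \<in> order_ge N"
    by (rule order_ge_mono[OF in_order_ge_subdegree]; simp add: N_def)+
  show "op_of_coeffs c (u + v) = op_of_coeffs c u + op_of_coeffs c v"
    by (rule fls_eqI) 
      (simp add: op_of_coeffs_nth[OF order_ge_add[OF u v]] op_of_coeffs_nth[OF u] op_of_coeffs_nth[OF v]
         sum.distrib algebra_simps)
  show "op_of_coeffs c (fls_const a * v) = fls_const a * op_of_coeffs c v"
    by (rule fls_eqI) 
      (simp add: op_of_coeffs_nth[OF order_ge_const_mult[OF v]] op_of_coeffs_nth[OF v] 
         sum_distrib_left mult.left_commute)
next
  fix N and v :: "'a fls" assume "v \<in> order_ge N"
  then show "op_of_coeffs c v \<in> order_ge (N + 0)"
    by (intro order_geI) (simp add: op_of_coeffs_nth)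
qed

lemma op_of_coeffs_poly_coeffs: "poly_coeffs (op_of_coeffs c)"
  unfolding poly_coeffs_def
proof
  fix k
  show "\<exists>p. \<forall>n. fls_nth (op_of_coeffs c (fls_X_intpow n)) (n + k) = poly p (of_int n)"
    by (rule exI[of _ "if k < 0 then 0 else c (nat k)"]) (simp add: op_of_coeffs_intpow)
qed

definition straighten :: "nat \<Rightarrow> 'a::field_char_0 fps \<Rightarrow> 'a fls \<Rightarrow> 'a fls" where
  "straighten s q = op_of_coeffs (straighten_coeff s q)"

lemma straighten_filtered: "filtered_op 0 (straighten s q)"
  by (simp add: straighten_def op_of_coeffs_filtered)

lemma straighten_poly_coeffs: "poly_coeffs (straighten s q)"
  by (simp add: straighten_def op_of_coeffs_poly_coeffs)

lemma straighten_intpow: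
  "fls_nth (straighten s q (fls_X_intpow n)) (n + k) =
     (if k < 0 then 0 else poly (straighten_coeff s q (nat k)) (of_int n))"
  by (simp add: straighten_def op_of_coeffs_intpow)

lemma straighten_1 [simp]: "s > 0 \<Longrightarrow> straighten s q 1 = 1"
proof (rule fls_eqI)
  fix n assume "s > 0"
  then show "fls_nth (straighten s q 1) n = fls_nth 1 n"
    using straighten_intpow[of s q 0 n] straighten_coeff_normalized[of s "nat n" q] 
    by (cases "n = 0") auto
qed

lemma euler_op_filtered: "filtered_op (- int s) (euler_op s q)"
proof -
  have "filtered_op 0 (\<lambda>v. fls_X * fls_deriv v)"
    unfolding filtered_op_def 
    by (auto simp: algebra_simps order_ge_def fls_X_times_conv_shift(1) intro!: fls_eqI)
  from filtered_op_comp[OF filtered_op_mult[OF order_ge_fps_to_fls[of q]] this]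
  have "filtered_op (- int s) (\<lambda>v. fps_to_fls q * (fls_X * fls_deriv v))"
    by (rule filtered_op_mono) simp
  moreover have "filtered_op (- int s) (\<lambda>v. fls_X_intpow (- int s) * v)"
    by (rule filtered_op_mult) simp
  ultimately show ?thesis
    unfolding euler_op_def by (rule filtered_op_add[rotated])
qed

lemma euler_op_intpow:
  "euler_op s q (fls_X_intpow n) = 
     fls_X_intpow (n - int s) + fls_const (of_int n) * (fps_to_fls q * fls_X_intpow n)"
proof -
  have "fls_X * fls_deriv (fls_X_intpow n) = fls_const (of_int n) * (fls_X_intpow n :: 'a fls)"
    by (rule fls_eqI) (auto simp: fls_X_times_conv_shift)
  then show ?thesis
    by (simp add: euler_op_def shift_1_times mult.left_commute del: fls_X_power_int)
qed

text \<open>The point of the construction: \<open>T\<close> turns \<open>\<theta>\<^sup>-\<^sup>1\<close> into multiplication by \<open>x\<^sup>-\<^sup>s\<close>, so that \<open>x\<^sup>s\<close> plays the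
  role of \<open>\<theta>\<close>. On monomials it is the difference equation for the coefficients.\<close>

lemma straighten_euler_op:
  assumes s: "s > 0"
  shows "straighten s q (euler_op s q v) = fls_X_intpow (- int s) * straighten s q v"
proof -
  let ?T = "straighten s q" and ?c = "straighten_coeff s q"
  define P where "P v = ?T (euler_op s q v) - fls_X_intpow (- int s) * ?T v" for v
  have P: "filtered_op (- int s) P"
    unfolding P_def
    using filtered_op_comp[OF straighten_filtered euler_op_filtered]
      filtered_op_comp[OF filtered_op_mult[of "fls_X_intpow (- int s)" "- int s"] straighten_filtered]
    by (intro filtered_op_diff) simp_all
  have "P (fls_X_intpow n) = 0" for n
  proof (rule fls_eqI)
    fix m
    define k where "k = m - n + int s"
    have m: "m = n - int s + k" "m = n + (k - int s)" by (simp_all add: k_def)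
    have T1: "fls_nth (?T (fls_X_intpow (n - int s))) m = 
        (if k < 0 then 0 else poly (?c (nat k)) (of_int (n - int s)))"
      unfolding m(1) by (rule straighten_intpow)
    have T2: "fls_nth (fls_X_intpow (- int s) * ?T (fls_X_intpow n)) m = 
        (if k < 0 then 0 else poly (?c (nat k)) (of_int n))"
      using straighten_intpow[of s q n k] by (simp add: shift_1_times k_def)
    have qn: "fps_to_fls q * fls_X_intpow n \<in> order_ge n"
      using order_ge_mult[OF order_ge_fps_to_fls[of q], of "fls_X_intpow n" n] by simp
    have "fls_nth (?T (fps_to_fls q * fls_X_intpow n)) m = 
      (\<Sum>i = n..m. poly (?c (nat (m - i))) (of_int i) * fps_nth q (nat (i - n)))"
      unfolding straighten_def op_of_coeffs_nth[OF qn]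
      by (intro sum.cong) (auto simp: fls_X_intpow_times_conv_shift)
    also have "\<dots> = (\<Sum>l | int l + int s \<le> k. fps_nth q (nat (k - int s - int l)) * 
       poly (?c l) (of_int (n + (k - int s - int l))))"
      by (rule sum.reindex_bij_witness[of _ "\<lambda>l. m - int l" "\<lambda>i. nat (m - i)"]) 
         (auto simp: k_def algebra_simps)
    finally have T3: "fls_nth (?T (fps_to_fls q * fls_X_intpow n)) m = \<dots>" .
    have eq: "fls_nth (P (fls_X_intpow n)) m = 
      fls_nth (?T (fls_X_intpow (n - int s))) m 
      + of_int n * fls_nth (?T (fps_to_fls q * fls_X_intpow n)) m
      - fls_nth (fls_X_intpow (- int s) * ?T (fls_X_intpow n)) m"
      unfolding P_def euler_op_intpow filtered_add[OF straighten_filtered] 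
        filtered_scale[OF straighten_filtered] by simp
    show "fls_nth (P (fls_X_intpow n)) m = fls_nth 0 m"
    proof (cases "k < 0")
      case True
      then have "{l. int l + int s \<le> k} = {}" by auto
      then show ?thesis unfolding eq T1 T2 T3 using True by simp
    next
      case False
      then obtain j where k: "k = int j" by (metis not_le nat_0_le)
      have "(\<Sum>l | int l + int s \<le> k. fps_nth q (nat (k - int s - int l)) * 
          poly (?c l) (of_int (n + (k - int s - int l)))) = 
        (\<Sum>l | l + s \<le> j. fps_nth q (j - s - l) * poly (?c l) (of_int (n + int (j - s - l))))"
      proof (rule sum.cong)
        fix l assume "l \<in> {l. l + s \<le> j}"
        then have "k - int s - int l = int (j - s - l)" by (simp add: k)
        then show "fps_nth q (nat (k - int s - int l)) * poly (?c l) (of_int (n + (k - int s - int l))) =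
            fps_nth q (j - s - l) * poly (?c l) (of_int (n + int (j - s - l)))"
          by simp
      qed (auto simp: k)
      then show ?thesis unfolding eq T1 T2 T3 
        using straighten_coeff_difference[OF s, of q j n] by (simp add: k algebra_simps)
    qed
  qed
  then have "P v = 0" by (rule filtered_op_eq_0[OF P])
  then show ?thesis by (simp add: P_def)
qed

section \<open>Substitutions and the difference operator\<close>

lemma fls_nth_powi_leading:
  fixes u :: "'a::field fls"
  shows "fls_nth (u powi n) (n * fls_subdegree u) = fls_nth u (fls_subdegree u) powi n"
proof (cases "u = 0")
  case False
  let ?d = "fls_subdegree u"
  have pow: "fls_nth (w ^ k) (int k * fls_subdegree w) = fls_nth w (fls_subdegree w) ^ k" 
    if "w \<noteq> 0" for w :: "'a fls" and k
  proof (induction k)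
    case (Suc k)
    have "w ^ k \<in> order_ge (int k * fls_subdegree w)"
      using that by (simp add: order_ge_subdegree_iff fls_subdegree_pow)
    from fls_nth_mult_leading[OF in_order_ge_subdegree[of w] this] Suc
    show ?case by (simp add: algebra_simps)
  qed simp
  have sub: "fls_subdegree (inverse u) = - ?d"
    using fls_subdegree_power_int[of u "-1"] by (simp add: power_int_minus)
  have "fls_nth (u * inverse u) (?d + - ?d) = fls_nth u ?d * fls_nth (inverse u) (- ?d)"
    using in_order_ge_subdegree[of "inverse u"] unfolding sub
    by (intro fls_nth_mult_leading in_order_ge_subdegree)
  then have inv: "fls_nth (inverse u) (- ?d) = inverse (fls_nth u ?d)"
    using False by (simp add: field_simps)
  show ?thesis
  proof (cases "n \<ge> 0")
    case True
    then show ?thesis using pow[OF False, of "nat n"] by (simp add: power_int_def)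
  next
    case neg: False
    then show ?thesis
      using pow[of "inverse u" "nat (- n)"] False by (simp add: power_int_def sub inv)
  qed
qed (auto simp: power_int_0_left_if)

lemma powi_in_order_ge:
  fixes u :: "'a::field fls"
  shows "u powi n \<in> order_ge (n * fls_subdegree u)"
  by (simp add: order_ge_subdegree_iff)

lemma inverse_in_order_ge: "inverse u \<in> order_ge (- fls_subdegree u)"
  for u :: "'a::field fls"
  using powi_in_order_ge[of u "- 1"] by (simp add: power_int_minus)

lemma fls_compose_fps_intpow:
  assumes "fps_nth H 0 = 0" "H \<noteq> 0"
  shows "fls_compose_fps (fls_X_intpow n) H = fps_to_fls H powi n"
  using fls_compose_fps_shift[of H "- n" 1] assms by simp

lemma subdegree_eq_1_iff: "subdegree H = 1 \<longleftrightarrow> fps_nth H 0 = 0 \<and> fps_nth H 1 \<noteq> 0"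
proof
  assume H: "subdegree H = 1"
  then have "H \<noteq> 0" by auto
  then show "fps_nth H 0 = 0 \<and> fps_nth H 1 \<noteq> 0"
    using nth_subdegree_nonzero[of H] nth_less_subdegree_zero[of 0 H] H by simp
qed (auto intro: subdegreeI)

lemma
  assumes H: "subdegree (H :: 'a::field fps) = 1"
  shows fls_compose_fps_filtered: "filtered_op 0 (\<lambda>v. fls_compose_fps v H)"
    and fls_compose_fps_intpow_leading: 
      "fls_nth (fls_compose_fps (fls_X_intpow n) H) n = fps_nth H 1 powi n"
proof -
  have H0: "fps_nth H 0 = 0" "H \<noteq> 0" using H subdegree_eq_1_iff[of H] by auto
  show "filtered_op 0 (\<lambda>v. fls_compose_fps v H)"
    unfolding filtered_op_def using H0 H
    by (auto simp: fls_compose_fps_add fls_compose_fps_mult order_ge_subdegree_iff)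
  show "fls_nth (fls_compose_fps (fls_X_intpow n) H) n = fps_nth H 1 powi n"
    using fls_nth_powi_leading[of "fps_to_fls H" n] H0
    by (simp add: fls_compose_fps_intpow fls_subdegree_fls_to_fps H)
qed

definition phi_series :: "nat \<Rightarrow> 'a::field_char_0 fps" where
  "phi_series s = fps_X * fps_compose (fps_binomial (- (1 / of_nat s))) (fps_X ^ s)"

lemma phi_ext_conv_compose: "phi_ext s v = fls_compose_fps v (phi_series s)"
  by (simp add: phi_ext_def phi_series_def)

lemma phi_series_nth:
  "fps_nth (phi_series s) 0 = 0" "s > 0 \<Longrightarrow> fps_nth (phi_series s) 1 = 1"
  by (simp_all add: phi_series_def)

lemma subdegree_phi_series [simp]: "s > 0 \<Longrightarrow> subdegree (phi_series s :: 'a::field_char_0 fps) = 1"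
  unfolding subdegree_eq_1_iff by (simp only: phi_series_nth) simp

lemma phi_series_nonzero [simp]: "s > 0 \<Longrightarrow> phi_series s \<noteq> (0 :: 'a::field_char_0 fps)"
  by (metis fps_zero_nth phi_series_nth(2) zero_neq_one)

lemma phi_ext_filtered: "s > 0 \<Longrightarrow> filtered_op 0 (phi_ext s)"
  using fls_compose_fps_filtered[OF subdegree_phi_series] by (simp add: phi_ext_conv_compose[abs_def])

lemma phi_ext_mult: "s > 0 \<Longrightarrow> phi_ext s (u * v) = phi_ext s u * phi_ext s v"
  by (simp add: phi_ext_conv_compose fls_compose_fps_mult phi_series_nth)

lemma phi_ext_1 [simp]: "phi_ext s 1 = 1"
  by (simp add: phi_ext_conv_compose)

lemma fps_binomial_compose_powi:
  assumes s: "s > 0"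
  shows "fps_to_fls (fps_compose (fps_binomial c) (fps_X ^ s)) powi n =
    fps_to_fls (fps_compose (fps_binomial (of_int n * c)) (fps_X ^ s) :: 'a::field_char_0 fps)"
proof -
  let ?b = "\<lambda>c. fps_to_fls (fps_compose (fps_binomial c) (fps_X ^ s) :: 'a fps)"
  have mult: "?b (c + d) = ?b c * ?b d" for c d
    using s by (simp add: fps_binomial_add_mult fps_compose_mult_distrib fls_times_fps_to_fls)
  have pow: "?b c ^ k = ?b (of_nat k * c)" for k c
    by (induction k) (simp_all add: algebra_simps mult)
  have "?b c * ?b (- c) = 1" using mult[of c "- c"] by simp
  then have inv: "inverse (?b c) = ?b (- c)" by (metis inverse_unique)
  show ?thesis
    by (cases "n \<ge> 0") (simp_all add: power_int_def pow inv)
qed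

lemma phi_ext_intpow:
  assumes s: "s > 0"
  shows "phi_ext s (fls_X_intpow n) = fls_X_intpow n * 
    fps_to_fls (fps_compose (fps_binomial (- (of_int n / of_nat s))) (fps_X ^ s))"
  unfolding phi_ext_conv_compose fls_compose_fps_intpow[OF phi_series_nth(1) phi_series_nonzero[OF s]]
  by (simp add: phi_series_def fls_times_fps_to_fls power_int_mult_distrib fps_binomial_compose_powi[OF s])

lemma phi_ext_intpow_nth:
  assumes s: "s > 0"
  shows "fls_nth (phi_ext s (fls_X_intpow n)) (n + k) = (if k < 0 \<or> \<not> int s dvd k then 0 
    else (- (of_int n / of_nat s)) gchoose (nat k div s))"
proof (cases "k < 0")
  case True
  then show ?thesis unfolding phi_ext_intpow[OF s] by (simp add: shift_1_times)
next
  case False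
  then have "s dvd nat k \<longleftrightarrow> int s dvd k" by (simp flip: int_dvd_int_iff)
  then show ?thesis
    using False unfolding phi_ext_intpow[OF s] by (simp add: shift_1_times fps_nth_compose_X_power)
qed

text \<open>The coefficient of a generalized binomial series is a polynomial in its exponent.\<close>

lemma phi_ext_poly_coeffs:
  assumes s: "s > 0"
  shows "poly_coeffs (phi_ext s :: 'a::field_char_0 fls \<Rightarrow> _)"
  unfolding poly_coeffs_def
proof
  fix k
  have gch: "poly (smult (1 / fact j) (\<Prod>i=0..<j. [:- of_nat i, - (1 / of_nat s):])) x = 
      (- (x / of_nat s)) gchoose j" for j and x :: 'a
    by (simp add: gbinomial_prod_rev poly_prod) (rule prod.cong; simp)
  show "\<exists>p. \<forall>n. fls_nth (phi_ext s (fls_X_intpow n) :: 'a fls) (n + k) = poly p (of_int n)"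
    by (rule exI[of _ "if k < 0 \<or> \<not> int s dvd k then 0 else
         smult (1 / fact (nat k div s)) (\<Prod>i=0..<nat k div s. [:- of_nat i, - (1 / of_nat s):])"])
       (simp add: phi_ext_intpow_nth[OF s] gch del: poly_smult)
qed

text \<open>With \<open>x\<^sup>s = \<theta>\<close> this is \<open>\<phi>(\<theta>\<^sup>-\<^sup>1) = \<theta>\<^sup>-\<^sup>1 + 1\<close>, the relation that \<open>\<Phi> = z\<close> satisfies with \<open>- z\<nabla>\<close>.\<close>

lemma phi_ext_inverse_theta:
  assumes s: "s > 0"
  shows "phi_ext s (fls_X_intpow (- int s)) = fls_X_intpow (- int s) + 1"
proof -
  have "phi_ext s (fls_X_intpow (- int s)) = fls_X_intpow (- int s) * (1 + fps_to_fls (fps_X ^ s))"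
    unfolding phi_ext_intpow[OF s] using s by (simp add: fps_binomial_1 fps_compose_add_distrib)
  also have "fps_to_fls (fps_X ^ s) = (fls_X_intpow (int s) :: 'a fls)"
    by (simp add: fps_to_fls_power fls_X_power_conv_shift_1)
  finally show ?thesis by (simp add: distrib_left shift_1_times)
qed

lemma fls_compose_power_conv_compose:
  assumes "q > 0"
  shows "fls_compose_power h q = fls_compose_fps h (fps_X ^ q)"
proof -
  obtain f n where h: "h = fls_shift n (fps_to_fls f)"
    using fls_as_fps'[of h "- fls_subdegree h"] by auto
  have "fps_to_fls (fps_X ^ q) powi (- n) = (fls_X_intpow (- (int q * n)) :: 'a fls)"
    using power_int_mult[of "fls_X :: 'a fls" "int q" "- n"] by (simp add: fps_to_fls_power)
  then show ?thesis using assms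
    by (simp add: h fls_compose_fps_shift fls_compose_power_fps_to_fls shift_1_times
        times_shift_1)
qed

lemma phi_ext_compose_power:
  fixes h :: "'a::field_char_0 fls"
  assumes s: "s > 0"
  shows "phi_ext s (fls_compose_power h s) = fls_compose_power (phi h) s"
proof -
  have 1: "fps_compose (fps_X ^ s) (phi_series s) = (phi_series s ^ s :: 'a fps)"
    by (simp add: phi_series_nth flip: fps_compose_power)
  have "(phi_series s ^ s :: 'a fps) = fps_X ^ s * fps_compose (fps_binomial (- 1)) (fps_X ^ s)"
    using s by (simp add: phi_series_def power_mult_distrib fps_compose_power fps_binomial_power)
  also have "\<dots> = fps_compose (phi_series 1) (fps_X ^ s)"
    using s by (simp add: phi_series_def fps_compose_mult_distrib)
  finally have 2: "phi_series s ^ s = \<dots>" .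
  have "fps_nth (fps_X ^ s :: 'a fps) 0 = 0" using s by simp
  moreover have "phi h = phi_ext 1 h" by (rule phi_ext_one[symmetric])
  ultimately show ?thesis
    using s trans[OF 1 2]
    by (simp add: fls_compose_power_conv_compose phi_ext_conv_compose fls_compose_fps_assoc phi_series_nth)
qed

text \<open>Write \<open>D\<close> for the Euler operator. The hypothesis on \<open>z\<close> says \<open>[D, z] = - z\<close>, the relation between
  \<open>\<theta>\<^sup>-\<^sup>1\<close> and \<open>\<Phi>\<close>. Hence the difference \<open>P\<close> of the two sides satisfies \<open>P D = (x\<^sup>-\<^sup>s + 1) P\<close>, which makes its
  lowest coefficient, a polynomial in \<open>n\<close>, periodic of period \<open>s\<close>. Such a polynomial is constant, and
  it is \<open>0\<close> because \<open>P 1 = 0\<close>; thus \<open>P\<close> gains order indefinitely.\<close>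

lemma straighten_intertwines:
  assumes s: "s > 0" and z: "fps_to_fls q * (fls_X * fls_deriv z) = - z"
  shows "straighten s q (z * v) = straighten s q z * phi_ext s (straighten s q v)"
proof -
  let ?T = "straighten s q" and ?D = "euler_op s q"
  define P where "P v = ?T (z * v) - ?T z * phi_ext s (?T v)" for v
  note T = straighten_filtered[of s q] straighten_poly_coeffs[of s q]
  note phi = phi_ext_filtered[OF s] phi_ext_poly_coeffs[OF s]
  define d where "d = fls_subdegree z"
  have z_d: "z \<in> order_ge d" and Tz_d: "?T z \<in> order_ge d"
    using filtered_order[OF T(1), of z d] by (simp_all add: d_def)
  note mult = filtered_op_mult[OF z_d] filtered_op_mult[OF Tz_d]
  note phiT = filtered_op_comp[OF phi(1) T(1)] poly_coeffs_comp[OF phi T]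
  have "filtered_op d P"
    unfolding P_def using filtered_op_comp[OF T(1) mult(1)] filtered_op_comp[OF mult(2) phiT(1)]
    by (intro filtered_op_diff) simp_all
  have P_poly: "poly_coeffs P"
    unfolding P_def
    by (intro poly_coeffs_diff poly_coeffs_comp[OF T mult(1) poly_coeffs_mult]
        poly_coeffs_comp[OF mult(2) poly_coeffs_mult phiT])
  have P_1: "P 1 = 0" using s by (simp add: P_def)
  have P_D: "P (?D v) = fls_X_intpow (- int s) * P v + P v" for v
  proof -
    have "?D (z * v) = z * ?D v + (fps_to_fls q * (fls_X * fls_deriv z)) * v"
      by (simp add: euler_op_def algebra_simps)
    then have "z * ?D v = ?D (z * v) + z * v" by (simp add: z)
    then have "?T (z * ?D v) = fls_X_intpow (- int s) * ?T (z * v) + ?T (z * v)"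
      by (simp only: filtered_add[OF T(1)] straighten_euler_op[OF s])
    moreover have "phi_ext s (?T (?D v)) = fls_X_intpow (- int s) * phi_ext s (?T v) + phi_ext s (?T v)"
      by (simp only: straighten_euler_op[OF s] phi_ext_mult[OF s] phi_ext_inverse_theta[OF s]) algebra
    ultimately show ?thesis unfolding P_def by algebra
  qed
  have "filtered_op (d + int k) P" for k
  proof (induction k)
    case 0
    then show ?case using \<open>filtered_op d P\<close> by simp
  next
    case (Suc k)
    define e where "e = d + int k"
    have P: "filtered_op e P" using Suc by (simp add: e_def)
    obtain p where p: "\<And>n. fls_nth (P (fls_X_intpow n)) (n + e) = poly p (of_int n)"
      using P_poly by (meson poly_coeffs_def)
    have "poly p (of_int (n - int s)) = poly p (of_int n)" for n
    proof -
      let ?m = "n - int s"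
      have Dn: "?D (fls_X_intpow n) \<in> order_ge ?m"
        using filtered_order[OF euler_op_filtered, of "fls_X_intpow n" n] by simp
      have qn: "fps_to_fls q * fls_X_intpow n \<in> order_ge n"
        using order_ge_mult[OF order_ge_fps_to_fls[of q], of "fls_X_intpow n" n] by simp
      have "fls_nth (?D (fls_X_intpow n)) ?m = 1"
        unfolding euler_op_intpow using order_geD[OF qn, of ?m] s by simp
      then have "fls_nth (P (?D (fls_X_intpow n))) (?m + e) = poly p (of_int ?m)"
        using filtered_leading[OF P Dn] p[of ?m] by simp
      moreover have "fls_nth (P (fls_X_intpow n)) (?m + e) = 0"
        by (rule order_geD[OF filtered_order[OF P, of _ n]]) (use s in simp_all)
      moreover have "fls_nth (fls_X_intpow (- int s) * P (fls_X_intpow n)) (?m + e) = poly p (of_int n)"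
        using p[of n] by (simp add: shift_1_times)
      ultimately show ?thesis unfolding P_D fls_plus_nth by simp
    qed
    moreover have "poly p 0 = 0" using p[of 0] P_1 by simp
    ultimately have "p = 0" by (rule poly_periodic_eq_0[OF s])
    then have "fls_nth (P (fls_X_intpow n)) (n + e) = 0" for n by (simp only: p) simp
    moreover have "P (fls_X_intpow n) \<in> order_ge (n + e)" for n
      by (rule filtered_order[OF P]) simp
    ultimately have "P (fls_X_intpow n) \<in> order_ge (n + e + 1)" for n
      by (simp only: order_ge_Suc_iff simp_thms)
    then have "filtered_op (e + 1) P"
      by (intro filtered_op_improve[OF P]) (simp add: add.assoc)
    then show ?case by (simp add: e_def ac_simps)
  qed
  then have "P v \<in> order_ge (fls_subdegree v + (d + int k))" for v k
    by (rule filtered_order) simp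
  then have "P v \<in> order_ge N" for N
    by (rule order_ge_mono[where N = "fls_subdegree v + (d + int (nat (N - fls_subdegree v - d)))"]) simp
  then have "P v = 0" by (rule order_ge_eq_0)
  then show ?thesis by (simp add: P_def)
qed

lemma straighten_leading: "fls_nth (straighten s q (fls_X_intpow n)) (n + 0) = 1"
  unfolding straighten_intpow by simp

text \<open>The first correction sits in relative order \<open>s\<close>, exactly the order in which the class of \<open>g\<close> is
  still sensitive; this is where the fraction in the formula for \<open>g\<close> comes from.\<close>

lemma straighten_second_term:
  assumes s: "s > 0" and v: "v \<in> order_ge N"
  shows "straighten s q v - v \<in> order_ge (N + int s)"
    and "fls_nth (straighten s q v - v) (N + int s) = 
      fls_nth v N * (fps_nth q 0 * of_int N * (of_int N + of_nat s) / (2 * of_nat s))"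
proof -
  define Q where "Q v = straighten s q v - v" for v
  have "filtered_op 0 Q"
    unfolding Q_def using filtered_op_mult[of 1 0]
    by (intro filtered_op_diff straighten_filtered) simp
  have Q_nth: "fls_nth (Q (fls_X_intpow n)) (n + k) = 
      (if k \<le> 0 then 0 else poly (straighten_coeff s q (nat k)) (of_int n))" for n k
    unfolding Q_def fls_minus_nth straighten_intpow by auto
  have "Q (fls_X_intpow n) \<in> order_ge (n + int s)" for n
  proof (rule order_geI)
    fix m assume "m < n + int s"
    then show "fls_nth (Q (fls_X_intpow n)) m = 0"
      using Q_nth[of n "m - n"] by (simp add: straighten_coeff_eq_0 split: if_splits)
  qed
  then have Q: "filtered_op (int s) Q" by (rule filtered_op_improve[OF \<open>filtered_op 0 Q\<close>])
  show "straighten s q v - v \<in> order_ge (N + int s)"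
    using filtered_order[OF Q v] by (simp add: Q_def)
  show "fls_nth (straighten s q v - v) (N + int s) = 
      fls_nth v N * (fps_nth q 0 * of_int N * (of_int N + of_nat s) / (2 * of_nat s))"
    using filtered_leading[OF Q v] s unfolding Q_nth by (simp add: Q_def straighten_coeff_first)
qed

text \<open>Why \<open>D\<^sub>g\<close> only depends on \<open>g\<close> modulo the subgroup \<open>1 + (\<int>/s) \<theta> + \<dots>\<close>: its elements are
  quotients \<open>\<phi>(y)/y\<close>. Indeed \<open>\<phi>(x\<^sup>n)/x\<^sup>n = 1 - (n/s) x\<^sup>s + \<dots>\<close>, so \<open>y\<close> starts with \<open>x\<^sup>m\<close>, and the leading
  coefficient \<open>-(n - m)/s\<close> of \<open>\<phi> - h\<close> at \<open>x\<^sup>n\<close> does not vanish for \<open>n > m\<close>.\<close>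

lemma phi_ext_eigenvector_ex:
  fixes h :: "'a::field_char_0 fls" and m :: int
  assumes s: "s > 0" 
    and h: "h - (1 - fls_const (of_int m / of_nat s) * fls_X_intpow (int s)) \<in> order_ge (int s + 1)"
  shows "\<exists>y. y \<noteq> 0 \<and> phi_ext s y = h * y"
proof -
  define L where "L v = phi_ext s v - h * v" for v
  have h_nth: "fls_nth h k = (if k = 0 then 1 else if k = int s then - (of_int m / of_nat s) else 0)"
    if "k \<le> int s" for k
    using order_geD[OF h, of k] that s by (auto simp: algebra_simps shift_1_times eq_neg_iff_add_eq_0)
  have "h \<in> order_ge 0" by (rule order_geI) (use h_nth in auto)
  then have L0: "filtered_op 0 L"
    unfolding L_def by (intro filtered_op_diff phi_ext_filtered[OF s] filtered_op_mult)
  have L_nth: "fls_nth (L (fls_X_intpow n)) (n + k) = 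
     (if k = int s then - (of_int (n - m) / of_nat s) else 0)" if "k \<le> int s" for n k
  proof -
    have "fls_nth (h * fls_X_intpow n) (n + k) = fls_nth h k"
      by (simp add: mult.commute[of h] shift_1_times)
    moreover have "k = int s" if "0 < k" "int s dvd k"
      using that \<open>k \<le> int s\<close> zdvd_imp_le by fastforce
    ultimately show ?thesis
      using that s unfolding L_def fls_minus_nth phi_ext_intpow_nth[OF s]
      by (auto simp: h_nth gbinomial_1 diff_divide_distrib)
  qed
  have "L (fls_X_intpow n) \<in> order_ge (n + int s)" for n
  proof (rule order_geI)
    fix k assume "k < n + int s"
    then show "fls_nth (L (fls_X_intpow n)) k = 0" using L_nth[of "k - n" n] by simp
  qed
  then have L: "filtered_op (int s) L" by (rule filtered_op_improve[OF L0])
  have "\<exists>v \<in> order_ge (m + 1). L v = - L (fls_X_intpow m)"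
  proof (rule filtered_op_surj[OF L])
    show "fls_nth (L (fls_X_intpow n)) (n + int s) \<noteq> 0" if "m + 1 \<le> n" for n
      unfolding L_nth[OF order.refl] using that s by simp
    have "fls_nth (L (fls_X_intpow m)) (m + int s) = 0"
      unfolding L_nth[OF order.refl] by simp
    moreover have "L (fls_X_intpow m) \<in> order_ge (m + int s)"
      by (rule filtered_order[OF L]) simp
    ultimately have "L (fls_X_intpow m) \<in> order_ge (m + int s + 1)"
      by (simp only: order_ge_Suc_iff simp_thms)
    then show "- L (fls_X_intpow m) \<in> order_ge (m + 1 + int s)" by (simp add: ac_simps)
  qed
  then obtain v where v: "v \<in> order_ge (m + 1)" "L v = - L (fls_X_intpow m)" by blast
  have "fls_nth (fls_X_intpow m + v) m = 1" using order_geD[OF v(1), of m] by simp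
  then have "fls_X_intpow m + v \<noteq> 0" by (metis fls_zero_nth zero_neq_one)
  moreover have "L (fls_X_intpow m + v) = 0" unfolding filtered_add[OF L] v(2) by simp
  ultimately show ?thesis
    by (intro exI[of _ "fls_X_intpow m + v"]) (simp add: L_def)
qed

section \<open>From the connection to the difference operator\<close>

lemma fls_deriv_powi:
  fixes u :: "'a::field fls"
  assumes "u \<noteq> 0"
  shows "fls_deriv (u powi n) = of_int n * u powi (n - 1) * fls_deriv u"
proof (cases "n > 0")
  case True
  define k where "k = nat (n - 1)"
  with True have n: "n = int (Suc k)" by simp
  then have "n - 1 = int k" by simp
  then show ?thesis
    using n fls_deriv_power[of u "Suc k"] by (simp only: power_int_of_nat of_int_of_nat_eq) simp
next
  case False
  define k where "k = nat (- n)"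
  with False have n: "n = - int k" by simp
  have 1: "u powi (n - 1) = inverse u ^ Suc k"
  proof -
    have "n - 1 = - int (Suc k)" using n by simp
    then show ?thesis by (simp only: power_int_minus power_int_of_nat power_inverse)
  qed
  have 2: "u powi n = inverse u ^ k" by (simp only: n power_int_minus power_int_of_nat power_inverse)
  have "fls_deriv (u powi n) = of_nat k * inverse u ^ (k - 1) * (- fls_deriv u * inverse u ^ 2)"
    using fls_inverse_deriv[of u] unfolding 2 fls_deriv_power by simp
  also have "\<dots> = of_int n * u powi (n - 1) * fls_deriv u"
    unfolding 1 unfolding n by (cases k) (simp_all add: power2_eq_square algebra_simps)
  finally show ?thesis .
qed

text \<open>Both sides are filtered operators in \<open>v\<close>, so the power rule on monomials suffices.\<close>

lemma fls_deriv_compose_fps: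
  fixes t :: "'a::field fps"
  assumes t: "subdegree t = 1"
  shows "fls_deriv (fls_compose_fps v t) = fls_compose_fps (fls_deriv v) t * fps_to_fls (fps_deriv t)"
proof -
  have t0: "fps_nth t 0 = 0" "t \<noteq> 0" using t subdegree_eq_1_iff[of t] by auto
  define P where "P v = fls_deriv (fls_compose_fps v t) - 
    fps_to_fls (fps_deriv t) * fls_compose_fps (fls_deriv v) t" for v
  have D: "filtered_op (- 1) (fls_deriv :: 'a fls \<Rightarrow> _)"
    by (auto simp: filtered_op_def order_ge_def)
  note C = fls_compose_fps_filtered[OF t]
  have P: "filtered_op (- 1) P"
    unfolding P_def using filtered_op_comp[OF D C] 
     filtered_op_comp[OF filtered_op_mult[OF order_ge_fps_to_fls] filtered_op_comp[OF C D]]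
    by (intro filtered_op_diff) simp_all
  have "P (fls_X_intpow n) = 0" for n
  proof -
    have "fls_deriv (fls_X_intpow n) = (of_int n * fls_X_intpow (n - 1) :: 'a fls)"
      using fls_deriv_powi[of "fls_X :: 'a fls" n] by simp
    then have "P (fls_X_intpow n) = fls_deriv (fps_to_fls t powi n) - 
        fps_to_fls (fps_deriv t) * (of_int n * fps_to_fls t powi (n - 1))"
      unfolding P_def by (simp only: fls_compose_fps_mult[OF t0(2,1)] fls_compose_fps_of_int
        fls_compose_fps_intpow[OF t0])
    then show ?thesis
      using t0 by (simp add: fls_deriv_powi fls_deriv_fps_to_fls)
  qed
  then have "P v = 0" by (rule filtered_op_eq_0[OF P])
  then show ?thesis by (simp add: P_def mult.commute)
qed

lemma z_nabla_E_obj: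
  assumes r: "r > 0"
  shows "z_nabla (E_obj r f) v = f * v - fls_const (1 / of_nat r) * (fls_X * fls_deriv v)"
proof -
  have "z_nabla (E_obj r f) v = fls_X_intpow (- int r) * 
      (- (fls_const (1 / of_nat r) * fls_X ^ (r + 1) * fls_deriv v) + fls_X ^ r * f * v)"
    using r by (simp add: z_nabla_def E_obj_def d_dz_def)
  also have "\<dots> = (fls_X_intpow (- int r) * fls_X ^ r) * 
      (f * v - fls_const (1 / of_nat r) * (fls_X * fls_deriv v))"
    by (simp only: power_add power_one_right ring_distribs) (simp only: mult_ac mult_minus_right
         mult_minus_left add.commute diff_conv_add_uminus)
  also have "fls_X_intpow (- int r) * fls_X ^ r = (1 :: 'a fls)"
    by (simp add: fls_X_power_conv_shift_1 shift_1_times)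
  finally show ?thesis by simp
qed

lemma fls_subdegree_eq_of_leading_term:
  fixes f :: "'a::field fls"
  assumes "a \<noteq> 0" "f - fls_const a * fls_X_intpow n \<in> order_ge (n + 1)"
  shows "fls_subdegree f = n" and "fls_nth f n = a"
proof -
  have nth: "fls_nth f k = (if k = n then a else 0)" if "k \<le> n" for k
    using order_geD[OF assms(2), of k] that by (auto simp: split: if_splits)
  show "fls_subdegree f = n" using nth assms(1) by (intro fls_subdegree_eqI) auto
  show "fls_nth f n = a" using nth by simp
qed

text \<open>Comparing orders in \<open>f(t) = - x\<^sup>-\<^sup>s\<close> forces \<open>t\<close> to be a uniformizer.\<close>

lemma mellin_systemE:
  fixes f :: "'a::field_char_0 fls"
  assumes sys: "mellin_system s r a f g" and s: "s > 0" and a: "a \<noteq> 0"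
    and f: "fls_subdegree f = - int s"
  obtains t z b where "subdegree t = 1" "z = fps_to_fls t powi (- int r)"
    "fls_compose_fps f t = - fls_X_intpow (- int s)" "b \<noteq> 0" 
    "fls_subdegree z = - int r" "fls_nth z (- int r) = b"
    "g = z - fls_const (b * (of_nat (r + s) / of_nat (2 * s))) * fls_X_intpow (int s - int r)"
proof -
  from sys obtain t z b where t: "fps_nth t 0 = 0" "z * fps_to_fls t ^ r = 1"
    "fls_compose_fps f t = - fls_X_intpow (- int s)" "b ^ s = (- a) powi (- int r)"
    "z - fls_const b * fls_X_intpow (- int r) \<in> small_o (- int r)"
    "g = z - fls_const (b * (of_nat (r + s) / of_nat (2 * s))) * fls_X_intpow (int s - int r)"
    unfolding mellin_system_def fls_X_power_int by blast
  have "- int s * int (subdegree t) = - int s"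
    using subdegree_fls_compose_fps[OF t(1), of f] unfolding t(3) f by simp
  then have "int (subdegree t) = 1" using s by simp
  then have sub: "subdegree t = 1" by simp
  have "z = inverse (fps_to_fls t ^ r)"
    using t(2) by (metis inverse_unique mult.commute)
  then have z: "z = fps_to_fls t powi (- int r)"
    by (simp add: power_int_minus)
  have "b ^ s \<noteq> 0" unfolding t(4) using a by simp
  then have b: "b \<noteq> 0" using s by (metis power_0_left neq0_conv)
  have z': "z - fls_const b * fls_X_intpow (- int r) \<in> order_ge (- int r + 1)"
    using t(5) by (simp add: small_o_eq_order_ge)
  show ?thesis
    by (rule that[OF sub z t(3) b fls_subdegree_eq_of_leading_term[OF b z'] t(6)])
qed

text \<open>\<open>\<Psi>\<close> is the substitution \<open>u = t(x)\<close>, followed by straightening and by multiplication with some \<open>y\<close>.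
  The first two steps carry \<open>\<Phi>\<close> to \<open>g' \<phi>\<close> with \<open>g' = T z = z (1 - (s - r)/(2s) x\<^sup>s + \<dots>)\<close>, whereas
  \<open>g = z (1 - (r + s)/(2s) x\<^sup>s + \<dots>)\<close>. The quotient is \<open>1 + (r/s) x\<^sup>s + \<dots>\<close>, and \<open>r/s \<in> \<int>/s\<close>, so that
  it equals \<open>\<phi>(y)/y\<close> for some \<open>y\<close>.\<close>

lemma mellin_intertwiner_ex:
  fixes f :: "'a::field_char_0 fls"
  assumes sys: "mellin_system s r a f g" and s: "s > 0" and r: "r > 0" and a: "a \<noteq> 0"
    and f: "fls_subdegree f = - int s"
  obtains \<Psi> d where "filtered_op d \<Psi>" "bij \<Psi>" "\<And>v N. \<Psi> v \<in> order_ge (N + d) \<longleftrightarrow> v \<in> order_ge N"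
    "\<And>v. \<Psi> (z_nabla (E_obj r f) v) = - (fls_X_intpow (- int s) * \<Psi> v)"
    "\<And>v. \<Psi> (fls_X_intpow (- int r) * v) = g * phi_ext s (\<Psi> v)"
proof -
  from mellin_systemE[OF sys s a f] obtain t z b where t: "subdegree t = 1" 
    and z: "z = fps_to_fls t powi (- int r)"
    and f_t: "fls_compose_fps f t = - fls_X_intpow (- int s)" and b: "b \<noteq> 0" 
    and z_sub: "fls_subdegree z = - int r" and z_lead: "fls_nth z (- int r) = b"
    and g: "g = z - fls_const (b * (of_nat (r + s) / of_nat (2 * s))) * fls_X_intpow (int s - int r)"
    by blast
  have t0: "fps_nth t 0 = 0" "t \<noteq> 0" and t1: "fps_nth t 1 \<noteq> 0"
    using t subdegree_eq_1_iff[of t] by auto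
  define \<sigma> where "\<sigma> v = fls_compose_fps v t" for v
  \<comment> \<open>\<open>q = t / (r x t')\<close>, so that \<open>(1/r) u d/du\<close> becomes \<open>q x d/dx\<close>.\<close>
  define q where "q = fps_const (1 / of_nat r) * (fps_shift 1 t * inverse (fps_deriv t))"
  have "fps_deriv t * inverse (fps_deriv t) = 1"
    using t1 by (subst mult.commute) (simp add: inverse_mult_eq_1)
  moreover have "fps_X * fps_shift 1 t = t"
    using t0 by (intro fps_ext) (simp add: fps_X_mult_nth)
  ultimately have "q * (fps_X * fps_deriv t) = fps_const (1 / of_nat r) * t"
    unfolding q_def by algebra
  from arg_cong[OF this, of fps_to_fls]
  have q: "fps_to_fls q * (fls_X * fps_to_fls (fps_deriv t)) = fls_const (1 / of_nat r) * fps_to_fls t"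
    by (simp add: fls_times_fps_to_fls)
  have q0: "fps_nth q 0 = 1 / of_nat r" using t1 by (simp add: q_def)

  have \<sigma>_nabla: "\<sigma> (z_nabla (E_obj r f) v) = - euler_op s q (\<sigma> v)" for v
  proof -
    have "\<sigma> (z_nabla (E_obj r f) v) = - fls_X_intpow (- int s) * \<sigma> v - 
        fls_const (1 / of_nat r) * fps_to_fls t * fls_compose_fps (fls_deriv v) t"
      by (simp add: z_nabla_E_obj[OF r] \<sigma>_def fls_compose_fps_diff[OF t0(2,1)] 
         fls_compose_fps_mult[OF t0(2,1)] f_t mult.assoc del: fls_X_power_int)
    also have "\<dots> = - euler_op s q (\<sigma> v)"
      unfolding euler_op_def \<sigma>_def fls_deriv_compose_fps[OF t] q[symmetric]
      by (simp add: algebra_simps)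
    finally show ?thesis .
  qed
  have z_ode: "fps_to_fls q * (fls_X * fls_deriv z) = - z"
  proof -
    let ?t = "fps_to_fls t"
    have "fps_to_fls q * (fls_X * fls_deriv z) = 
        of_int (- int r) * ?t powi (- int r - 1) * (fps_to_fls q * (fls_X * fps_to_fls (fps_deriv t)))"
      using t0 by (simp add: z fls_deriv_powi fls_deriv_fps_to_fls mult_ac)
    also have "\<dots> = (of_int (- int r) * fls_const (1 / of_nat r)) * (?t powi (- int r - 1) * ?t powi 1)"
      unfolding q by simp
    also have "?t powi (- int r - 1) * ?t powi 1 = z"
      using t0 by (subst power_int_add[symmetric]) (simp_all add: z)
    also have "of_int (- int r) * fls_const (1 / of_nat r) = (- 1 :: 'a fls)"
      using r by (simp add: fls_of_nat)
    finally show ?thesis by simp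
  qed

  define g' where "g' = straighten s q z"
  have z_ge: "z \<in> order_ge (- int r)" using z_sub in_order_ge_subdegree[of z] by simp
  have g'_z: "g' - z \<in> order_ge (- int r + int s)"
    "fls_nth (g' - z) (- int r + int s) = - b * (of_int (int s - int r) / of_nat (2 * s))"
    using straighten_second_term[OF s z_ge, of q] r s unfolding g'_def[symmetric] 
    by (simp_all add: q0 z_lead field_simps)
  have g_z: "g - z = - fls_const (b * (of_nat (r + s) / of_nat (2 * s))) * fls_X_intpow (- int r + int s)"
    by (simp add: g del: fls_X_power_int)
  have g_ge: "g \<in> order_ge (- int r)"
  proof -
    have "g - z \<in> order_ge (- int r)" unfolding g_z mult_minus_left order_ge_uminus_iff
      by (rule order_ge_const_mult) simp
    from order_ge_add[OF this z_ge] show ?thesis by simp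
  qed
  have g_lead: "fls_nth g (- int r) = b"
    using arg_cong[OF g_z, of "\<lambda>v. fls_nth v (- int r)"] s z_lead 
    by (simp add: times_shift_1)
  have g_sub: "fls_subdegree g = - int r"
    using g_lead b order_geD[OF g_ge] by (intro fls_subdegree_eqI) auto
  have g_0: "g \<noteq> 0" using g_lead b by auto
  define h where "h = g' / g"
  \<comment> \<open>The error in \<open>h = 1 + (r/s) x\<^sup>s + \<dots>\<close>, multiplied by \<open>g\<close>.\<close>
  define e where "e = g' - (1 - fls_const (of_int (- int r) / of_nat s) * fls_X_intpow (int s)) * g"
  have e_eq: "e = (g' - z) - (g - z) + fls_const (of_int (- int r) / of_nat s) * (fls_X_intpow (int s) * g)"
    by (simp add: e_def algebra_simps)
  have "e \<in> order_ge (- int r + int s)"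
  proof -
    have "g - z \<in> order_ge (- int r + int s)"
      unfolding g_z mult_minus_left order_ge_uminus_iff by (rule order_ge_const_mult) simp
    moreover have "fls_const (of_int (- int r) / of_nat s) * (fls_X_intpow (int s) * g) 
        \<in> order_ge (- int r + int s)"
      by (rule order_ge_const_mult) (use g_ge in simp)
    ultimately show ?thesis
      unfolding e_eq by (rule order_ge_add[OF order_ge_diff[OF g'_z(1)]])
  qed
  moreover have "fls_nth e (- int r + int s) = 0"
  proof -
    have "fls_nth (g - z) (- int r + int s) = - (b * (of_nat (r + s) / of_nat (2 * s)))"
      unfolding g_z by simp
    moreover have "fls_nth (fls_X_intpow (int s) * g) (- int r + int s) = b"
      using g_lead by (simp add: shift_1_times)
    moreover have "fls_nth e (- int r + int s) = fls_nth (g' - z) (- int r + int s) - 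
        fls_nth (g - z) (- int r + int s) + 
        of_int (- int r) / of_nat s * fls_nth (fls_X_intpow (int s) * g) (- int r + int s)"
      by (simp only: e_eq fls_plus_nth fls_minus_nth fls_mult_const_nth)
    ultimately have "fls_nth e (- int r + int s) = - b * (of_int (int s - int r) / of_nat (2 * s)) + 
        b * (of_nat (r + s) / of_nat (2 * s)) + of_int (- int r) / of_nat s * b"
      by (simp only: g'_z(2) diff_minus_eq_add)
    then show ?thesis using s by (simp add: field_simps)
  qed
  ultimately have "e \<in> order_ge (- int r + int s + 1)" by (simp only: order_ge_Suc_iff simp_thms)
  moreover have "inverse g \<in> order_ge (int r)"
    using inverse_in_order_ge[of g] by (simp add: g_sub)
  ultimately have "e * inverse g \<in> order_ge (int s + 1)"
    using order_ge_mult by fastforce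
  also have "e * inverse g = h - (1 - fls_const (of_int (- int r) / of_nat s) * fls_X_intpow (int s))"
    using g_0 by (simp add: e_def h_def field_simps)
  finally obtain y where y: "y \<noteq> 0" "phi_ext s y = h * y"
    using phi_ext_eigenvector_ex[OF s] by blast

  define \<Psi> where "\<Psi> v = y * straighten s q (\<sigma> v)" for v
  define d where "d = fls_subdegree y"
  have \<sigma>: "filtered_op 0 \<sigma>"
    unfolding \<sigma>_def by (rule fls_compose_fps_filtered[OF t])
  have T\<sigma>: "filtered_op 0 (\<lambda>v. straighten s q (\<sigma> v))"
    using filtered_op_comp[OF straighten_filtered \<sigma>] by simp
  have \<Psi>: "filtered_op d \<Psi>"
    using filtered_op_comp[OF filtered_op_mult[OF in_order_ge_subdegree[of y]] T\<sigma>] 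
    by (simp add: \<Psi>_def[abs_def] d_def)
  have lead: "fls_nth (\<Psi> (fls_X_intpow n)) (n + d) \<noteq> 0" for n
  proof -
    have \<sigma>_n: "\<sigma> (fls_X_intpow n) \<in> order_ge n" 
      using filtered_order[OF \<sigma>, of "fls_X_intpow n" n] by simp
    have "straighten s q (\<sigma> (fls_X_intpow n)) \<in> order_ge n"
      using filtered_order[OF straighten_filtered \<sigma>_n] by simp
    from fls_nth_mult_leading[OF this in_order_ge_subdegree[of y]]
    have "fls_nth (\<Psi> (fls_X_intpow n)) (n + d) = 
       fls_nth (straighten s q (\<sigma> (fls_X_intpow n))) n * fls_nth y d"
      by (simp add: \<Psi>_def d_def mult.commute)
    also have "fls_nth (straighten s q (\<sigma> (fls_X_intpow n))) n = fps_nth t 1 powi n"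
      using filtered_leading[OF straighten_filtered \<sigma>_n, of s q] straighten_leading[of s q n]
      by (simp add: \<sigma>_def fls_compose_fps_intpow_leading[OF t])
    finally show ?thesis using t1 y(1) by (simp add: d_def)
  qed
  show ?thesis
  proof (rule that[OF \<Psi> filtered_bij[OF \<Psi> lead] filtered_order_iff[OF \<Psi> lead]])
    fix v
    show "\<Psi> (z_nabla (E_obj r f) v) = - (fls_X_intpow (- int s) * \<Psi> v)"
      unfolding \<Psi>_def \<sigma>_nabla filtered_uminus[OF straighten_filtered] straighten_euler_op[OF s]
      by (simp add: mult_ac)
    have "\<sigma> (fls_X_intpow (- int r) * v) = z * \<sigma> v"
      unfolding \<sigma>_def fls_compose_fps_mult[OF t0(2,1)] fls_compose_fps_intpow[OF t0] z ..
    then have "\<Psi> (fls_X_intpow (- int r) * v) = y * (g' * phi_ext s (straighten s q (\<sigma> v)))"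
      unfolding \<Psi>_def g'_def by (simp only: straighten_intertwines[OF s z_ode])
    also have "\<dots> = g * phi_ext s (\<Psi> v)"
      unfolding \<Psi>_def phi_ext_mult[OF s] y(2) h_def using g_0 by simp
    finally show "\<Psi> (fls_X_intpow (- int r) * v) = g * phi_ext s (\<Psi> v)" .
  qed
qed

section \<open>Lattices and the adic topology\<close>

text \<open>Sort the exponents by their residue modulo \<open>r\<close>.\<close>

lemma order_ge_decompose:
  fixes v :: "'a::field fls"
  assumes r: "r > 0" and v: "v \<in> order_ge m"
  obtains c where "v = (\<Sum>i<r. fls_compose_power (fps_to_fls (c i)) r * fls_X_intpow (m + int i))"
proof
  define c where "c i = Abs_fps (\<lambda>k. fls_nth v (m + int i + int r * int k))" for i
  show "v = (\<Sum>i<r. fls_compose_power (fps_to_fls (c i)) r * fls_X_intpow (m + int i))"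
  proof (rule fls_eqI)
    fix n
    have "fls_nth (fls_compose_power (fps_to_fls (c i)) r * fls_X_intpow (m + int i)) n =
        (if i = nat ((n - m) mod int r) then fls_nth v n else 0)" if i: "i < r" for i
    proof -
      have "fls_nth (w * fls_X_intpow k) n = fls_nth w (n - k)" for w :: "'a fls" and k
        by (simp add: times_shift_1)
      then have eq: "fls_nth (fls_compose_power (fps_to_fls (c i)) r * fls_X_intpow (m + int i)) n = 
          (if int r dvd n - m - int i then fls_nth (fps_to_fls (c i)) ((n - m - int i) div int r) else 0)"
        by (simp only: fls_nth_compose_power[OF r] diff_diff_eq)
      have mod: "int r dvd n - m - int i \<longleftrightarrow> i = nat ((n - m) mod int r)"
      proof
        assume "int r dvd n - m - int i"
        then have "(n - m) mod int r = int i mod int r" by (simp add: mod_eq_dvd_iff)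
        then show "i = nat ((n - m) mod int r)" using i by simp
      next
        assume "i = nat ((n - m) mod int r)"
        then have "int i = (n - m) mod int r" using r by simp
        then show "int r dvd n - m - int i" by (metis dvd_minus_mod)
      qed
      show ?thesis
      proof (cases "int r dvd n - m - int i")
        case True
        then obtain k where k: "n - m - int i = int r * k" by blast
        have k': "(n - m - int i) div int r = k" using k r by simp
        have c_k: "fls_nth (fps_to_fls (c i)) k = fls_nth v n"
        proof (cases "k \<ge> 0")
          case True
          then have "m + int i + int r * int (nat k) = n" using k by simp
          then show ?thesis using True by (simp add: c_def)
        next
          case False
          then have "int r * k \<le> int r * (- 1)" using r by (intro mult_left_mono) auto
          then have "n < m" using k i by linarith
          then show ?thesis using False order_geD[OF v] by simp
        qed
        show ?thesis
          unfolding eq if_P[OF True] if_P[OF iffD1[OF mod True]] k' by (rule c_k)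
      next
        case False
        then have "i \<noteq> nat ((n - m) mod int r)" unfolding mod .
        then show ?thesis unfolding eq if_not_P[OF False] by simp
      qed
    qed
    then have "fls_nth (\<Sum>i<r. fls_compose_power (fps_to_fls (c i)) r * fls_X_intpow (m + int i)) n = 
       (\<Sum>i<r. if i = nat ((n - m) mod int r) then fls_nth v n else 0)"
      by (simp add: fls_nth_sum)
    also have "\<dots> = fls_nth v n" using r by (simp add: nat_less_iff)
    finally show "fls_nth v n = 
      fls_nth (\<Sum>i<r. fls_compose_power (fps_to_fls (c i)) r * fls_X_intpow (m + int i)) n" ..
  qed
qed

lemma order_ge_0_regpart: "h \<in> order_ge 0 \<Longrightarrow> fps_to_fls (fls_regpart h) = h"
  by (cases "h = 0") (auto simp: order_ge_subdegree_iff)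

text \<open>The \<open>k((\<zeta>))\<close>-structure of \<open>E\<^sub>f\<close>, and that of \<open>D\<^sub>g\<close> over \<open>k((\<theta>))\<close>.\<close>

abbreviation (input) ramified_scale :: "nat \<Rightarrow> 'a::field fls \<Rightarrow> 'a fls \<Rightarrow> 'a fls" where
  "ramified_scale r \<equiv> (\<lambda>h v. fls_compose_power h r * v)"

lemma vector_space_ramified_scale:
  assumes "r > 0"
  shows "vector_space (ramified_scale r)"
  using assms by unfold_locales (simp_all add: algebra_simps)

lemma fls_compose_power_in_order_ge:
  assumes "r > 0" "h \<in> order_ge N"
  shows "fls_compose_power h r \<in> order_ge (int r * N)"
proof (rule order_geI)
  fix n assume n: "n < int r * N"
  show "fls_nth (fls_compose_power h r) n = 0"
  proof (cases "int r dvd n")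
    case True
    then obtain k where k: "n = int r * k" by blast
    then have "k < N" using n assms(1) by simp
    then show ?thesis using k assms by (simp add: fls_nth_compose_power order_geD)
  qed (use assms in \<open>simp add: fls_nth_compose_power\<close>)
qed

text \<open>This lemma and the next one show that the lattices define the topology of the order of vanishing:
  the sets \<open>order_ge m\<close> are themselves lattices, and every lattice contains one of them.\<close>

lemma is_lattice_order_ge:
  assumes r: "r > 0"
  shows "is_lattice (ramified_scale r) (order_ge m :: 'a::field fls set)"
proof -
  interpret vs: vector_space "ramified_scale r :: 'a fls \<Rightarrow> _" by (rule vector_space_ramified_scale[OF r])
  define b :: "nat \<Rightarrow> 'a fls" where "b i = fls_X_intpow (m + int i)" for i
  define B where "B = b ` {..<r}"
  have b_sub: "fls_subdegree (b i) = m + int i" for i by (simp add: b_def)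
  then have "inj_on b {..<r}" by (intro inj_onI) (metis add_left_cancel of_nat_eq_iff)
  then have sum_B: "(\<Sum>u\<in>B. F u) = (\<Sum>i<r. F (b i))" for F :: "'a fls \<Rightarrow> 'a fls"
    by (simp add: B_def sum.reindex)
  define lin where "lin c = (\<Sum>u\<in>B. ramified_scale r (fps_to_fls (c u)) u)" for c :: "'a fls \<Rightarrow> 'a fps"
  have lin_ge: "lin c \<in> order_ge m" for c
    unfolding lin_def sum_B
  proof (intro order_ge_sum)
    fix i assume "i \<in> {..<r}"
    have "fls_compose_power (fps_to_fls (c (b i))) r * b i \<in> order_ge (int r * 0 + m)"
      by (intro order_ge_mult fls_compose_power_in_order_ge r) (simp_all add: b_def)
    then show "fls_compose_power (fps_to_fls (c (b i))) r * b i \<in> order_ge m" by simp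
  qed
  have ex: "\<exists>c. v = lin c" if "v \<in> order_ge m" for v
  proof -
    from order_ge_decompose[OF r that] obtain c where
      c: "v = (\<Sum>i<r. fls_compose_power (fps_to_fls (c i)) r * fls_X_intpow (m + int i))" .
    have "v = lin (\<lambda>u. c (nat (fls_subdegree u - m)))"
      unfolding lin_def sum_B c by (simp add: b_sub) (simp add: b_def)
    then show ?thesis by blast
  qed
  have lin_span: "lin c \<in> vs.span B" for c
    unfolding lin_def by (intro vs.span_sum vs.span_scale vs.span_base)
  have "v \<in> vs.span B" for v
  proof -
    \<comment> \<open>Multiplication by \<open>\<zeta>\<^sup>k\<close> moves \<open>v\<close> into \<open>order_ge m\<close>.\<close>
    define k where "k = nat (m - fls_subdegree v)"
    have "int k \<le> int r * int k" using mult_right_mono[of 1 "int r" "int k"] r by simp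
    moreover have "m \<le> fls_subdegree v + int k" by (simp add: k_def)
    ultimately have "fls_X_intpow (int r * int k) * v \<in> order_ge m"
      unfolding order_ge_mult_intpow_iff by (intro order_ge_mono[OF in_order_ge_subdegree]) linarith
    then have "fls_X_intpow (int r * int k) * v \<in> vs.span B" using ex lin_span by metis
    then have "ramified_scale r (fls_X_intpow (- int k)) (fls_X_intpow (int r * int k) * v) \<in> vs.span B"
      by (rule vs.span_scale)
    then show ?thesis using r by (simp add: shift_1_times)
  qed
  then have "vs.span B = UNIV" by auto
  moreover have "order_ge m = range lin" using ex lin_ge by blast
  ultimately show ?thesis
    unfolding is_lattice_def lin_def by (intro exI[of _ B]) (simp add: B_def)
qed

text \<open>Express \<open>1, u, \<dots>, u\<^sup>r\<^sup>-\<^sup>1\<close> in the generators and clear denominators by a power \<open>\<zeta>\<^sup>N\<close>.\<close>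

lemma lattice_contains_order_ge:
  fixes L :: "'a::field fls set"
  assumes r: "r > 0" and L: "is_lattice (ramified_scale r) L"
  obtains M where "order_ge M \<subseteq> L"
proof -
  interpret vs: vector_space "ramified_scale r :: 'a fls \<Rightarrow> _" by (rule vector_space_ramified_scale[OF r])
  from L obtain B where B: "finite B" "vs.span B = UNIV"
    and L_eq: "L = range (\<lambda>c. \<Sum>b\<in>B. ramified_scale r (fps_to_fls (c b)) b)"
    unfolding is_lattice_def by blast
  have "\<forall>i. \<exists>u. fls_X_intpow (int i) = (\<Sum>b\<in>B. ramified_scale r (u b) b)"
    using B(2) unfolding vs.span_finite[OF B(1)] by blast
  then obtain u where u: "fls_X_intpow (int i) = (\<Sum>b\<in>B. ramified_scale r (u i b) b)" for i by metis
  define N where "N = Max (insert 0 ((\<lambda>(i, b). - fls_subdegree (u i b)) ` ({..<r} \<times> B)))"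
  have N: "fls_X_intpow N * u i b \<in> order_ge 0" if "i < r" "b \<in> B" for i b
  proof -
    have "- fls_subdegree (u i b) \<le> N"
      unfolding N_def using B(1) that by (intro Max_ge) auto
    then show ?thesis unfolding order_ge_mult_intpow_iff
      by (intro order_ge_mono[OF in_order_ge_subdegree]) simp
  qed
  have "v \<in> L" if v: "v \<in> order_ge (int r * N)" for v
  proof -
    have "fls_X_intpow (- (int r * N)) * v \<in> order_ge 0"
      unfolding order_ge_mult_intpow_iff using v by simp
    from order_ge_decompose[OF r this] obtain c where
      c: "fls_X_intpow (- (int r * N)) * v = (\<Sum>i<r. ramified_scale r (fps_to_fls (c i)) (fls_X_intpow (int i)))"
      by auto
    define C where "C b = (\<Sum>i<r. fps_to_fls (c i) * (fls_X_intpow N * u i b))" for b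
    have C_ge: "C b \<in> order_ge 0" if "b \<in> B" for b
      unfolding C_def using order_ge_mult[OF order_ge_fps_to_fls N[OF _ that]]
      by (intro order_ge_sum) auto
    have comp: "fls_compose_power (fls_X_intpow N) r = (fls_X_intpow (int r * N) :: 'a fls)"
      using r by simp
    have "v = fls_X_intpow (int r * N) * (fls_X_intpow (- (int r * N)) * v)"
      by (simp add: shift_1_times)
    also have "\<dots> = (\<Sum>i<r. ramified_scale r (fls_X_intpow N) 
        (ramified_scale r (fps_to_fls (c i)) (\<Sum>b\<in>B. ramified_scale r (u i b) b)))"
      unfolding c comp u[symmetric] by (simp add: sum_distrib_left)
    also have "\<dots> = (\<Sum>i<r. \<Sum>b\<in>B. 
        ramified_scale r (fps_to_fls (c i) * (fls_X_intpow N * u i b)) b)"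
      by (simp only: fls_compose_power_mult sum_distrib_left mult.assoc mult.left_commute)
    also have "\<dots> = (\<Sum>b\<in>B. ramified_scale r (C b) b)"
      unfolding C_def vs.scale_sum_left by (rule sum.swap)
    also have "\<dots> = (\<Sum>b\<in>B. ramified_scale r (fps_to_fls (fls_regpart (C b))) b)"
      using C_ge by (simp add: order_ge_0_regpart)
    finally show "v \<in> L" unfolding L_eq by (rule range_eqI[where x = "\<lambda>b. fls_regpart (C b)"])
  qed
  then show ?thesis using that by blast
qed

lemma adic_limitI:
  fixes X :: "nat \<Rightarrow> 'a::field fls"
  assumes r: "r > 0" and X: "\<And>M. \<forall>\<^sub>F n in sequentially. X n - w \<in> order_ge M"
  shows "adic_limit (ramified_scale r) X w"
  unfolding adic_limit_def
proof (intro allI impI)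
  fix L :: "'a fls set" assume "is_lattice (ramified_scale r) L"
  from lattice_contains_order_ge[OF r this] obtain M where "order_ge M \<subseteq> L" .
  then show "\<forall>\<^sub>F n in sequentially. X n - w \<in> L"
    using X[of M] by (auto elim: eventually_mono)
qed

lemma adic_limit_unique:
  fixes X :: "nat \<Rightarrow> 'a::field fls"
  assumes r: "r > 0" and w: "adic_limit (ramified_scale r) X w" "adic_limit (ramified_scale r) X w'"
  shows "w = w'"
proof -
  have "w' - w \<in> order_ge M" for M
  proof -
    have "\<forall>\<^sub>F n in sequentially. X n - w \<in> order_ge M \<and> X n - w' \<in> order_ge M"
      using w is_lattice_order_ge[OF r, of M] unfolding adic_limit_def
      by (intro eventually_conj) blast+
    then obtain n where "X n - w \<in> order_ge M" "X n - w' \<in> order_ge M"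
      by (metis (mono_tags, lifting) eventually_sequentially order.refl)
    from order_ge_diff[OF this] show ?thesis by simp
  qed
  then have "w' - w = 0" by (rule order_ge_eq_0)
  then show ?thesis by simp
qed

section \<open>Transport of the Mellin transform\<close>

lemma finite_dimensional_transport:
  fixes sc1 :: "'k::field \<Rightarrow> 'v::ab_group_add \<Rightarrow> 'v" and sc2 :: "'k \<Rightarrow> 'w::ab_group_add \<Rightarrow> 'w"
  assumes fd: "finite_dimensional_vector_space sc2 B" and T: "bij T"
    and add: "\<And>u v. T (u + v) = T u + T v" and scale: "\<And>c v. T (sc1 c v) = sc2 c (T v)"
  shows "vector_space sc1" "\<exists>B'. finite_dimensional_vector_space sc1 B'"
proof -
  interpret W: finite_dimensional_vector_space sc2 B by (rule fd)
  have eqI: "u = v" if "T u = T v" for u v using T that by (simp add: bij_is_inj inj_eq)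
  have T_inv: "T (inv T w) = w" for w using T by (simp add: bij_is_surj surj_f_inv_f)
  show V: "vector_space sc1"
    by unfold_locales
      (rule eqI, simp add: add scale W.scale_right_distrib W.scale_left_distrib)+
  interpret V: vector_space sc1 by (rule V)
  interpret S: Vector_Spaces.linear sc2 sc1 "inv T"
  proof unfold_locales
    show "inv T (b1 + b2) = inv T b1 + inv T b2" for b1 b2
      by (rule eqI) (simp add: add T_inv)
    show "inv T (sc2 c b) = sc1 c (inv T b)" for c b
      by (rule eqI) (simp add: scale T_inv)
  qed
  have inv: "bij (inv T)" using T by (rule bij_imp_bij_inv)
  have "V.independent (inv T ` B)"
    by (rule S.independent_injective_image[OF W.independent_Basis]) 
      (use inv in \<open>auto intro: inj_on_subset simp: bij_def\<close>)
  moreover have "V.span (inv T ` B) = UNIV"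
    unfolding S.span_image W.span_Basis using inv by (simp add: bij_is_surj)
  ultimately have "finite_dimensional_vector_space sc1 (inv T ` B)"
    using W.finite_Basis by unfold_locales auto
  then show "\<exists>B'. finite_dimensional_vector_space sc1 B'" ..
qed

lemma diff_mod_iso_transport:
  fixes M :: "('a::field, 'v::ab_group_add) diff_mod" and N :: "('a, 'w::ab_group_add) diff_mod"
  assumes N: "is_diff_mod N" and T: "bij T" and add: "\<And>u v. T (u + v) = T u + T v"
    and scale: "\<And>h v. T (dm_scale M h v) = dm_scale N h (T v)"
    and Phi: "\<And>v. T (dm_Phi M v) = dm_Phi N (T v)"
  shows "M \<simeq>\<^sub>N N"
proof -
  have "\<exists>B. finite_dimensional_vector_space (dm_scale N) B" and N_bij: "bij (dm_Phi N)"
    and N_add: "dm_Phi N (u + v) = dm_Phi N u + dm_Phi N v"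
    and N_scale: "dm_Phi N (dm_scale N h v) = dm_scale N (phi h) (dm_Phi N v)" for u v h
    using N by (simp_all add: is_diff_mod_def)
  then obtain B where B: "finite_dimensional_vector_space (dm_scale N) B" by metis
  have eqI: "u = v" if "T u = T v" for u v using T that by (simp add: bij_is_inj inj_eq)
  have Phi_M: "dm_Phi M = inv T \<circ> dm_Phi N \<circ> T"
    by (rule ext) (simp add: inv_f_f[OF bij_is_inj[OF T]] flip: Phi)
  have M_bij: "bij (dm_Phi M)"
    unfolding Phi_M by (intro bij_comp T N_bij bij_imp_bij_inv)
  note fd = finite_dimensional_transport[where T = T and ?sc1.0 = "dm_scale M" and ?sc2.0 = "dm_scale N", 
      OF B T add scale]
  have M: "is_diff_mod M"
    unfolding is_diff_mod_def
  proof (intro conjI allI fd(2) M_bij)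
    show "dm_Phi M (v + w) = dm_Phi M v + dm_Phi M w" for v w
      by (rule eqI) (simp add: Phi add N_add)
    show "dm_Phi M (dm_scale M h v) = dm_scale M (phi h) (dm_Phi M v)" for h v
      by (rule eqI) (simp add: Phi scale N_scale)
  qed
  interpret M: vector_space "dm_scale M" by (rule fd(1))
  interpret N: finite_dimensional_vector_space "dm_scale N" B by (rule B)
  have "Vector_Spaces.linear (dm_scale M) (dm_scale N) T"
    by unfold_locales (simp_all add: add scale)
  then show ?thesis
    unfolding diff_mod_iso_def by (intro conjI M N exI[of _ T] T allI Phi)
qed

lemma is_diff_mod_D_obj:
  assumes s: "s > 0" and g: "g \<noteq> 0"
  shows "is_diff_mod (D_obj s (g :: 'a::field_char_0 fls))"
proof -
  have "fls_nth (phi_ext s (fls_X_intpow n) :: 'a fls) (n + 0) \<noteq> 0" for n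
    unfolding phi_ext_intpow_nth[OF s] by simp
  then have "bij (phi_ext s :: 'a fls \<Rightarrow> _)"
    by (rule filtered_bij[OF phi_ext_filtered[OF s]])
  moreover have "bij (\<lambda>v. g * v)"
    by (rule bij_betw_byWitness[where f' = "\<lambda>v. v / g"]) (use g in auto)
  ultimately have "bij ((\<lambda>v. g * v) \<circ> phi_ext s)" by (rule bij_comp)
  then show ?thesis
    using Kq_finite_dimensional[OF s]
    by (simp add: is_diff_mod_def D_obj_def comp_def filtered_add[OF phi_ext_filtered[OF s]]
       phi_ext_mult[OF s] phi_ext_compose_power[OF s] algebra_simps)
qed

text \<open>The hypothesis on \<open>z\<nabla>\<close> says that \<open>\<Psi>\<close> carries \<open>\<theta>\<close> to multiplication by \<open>x\<^sup>s\<close>. As \<open>\<Psi>\<close> shifts orders by a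
  constant, it respects the limits that define the action of \<open>k((\<theta>))\<close>, which is therefore carried to the
  one on \<open>k((x))\<close>. All axioms for the transform are then inherited from \<open>D\<^sub>g\<close>.\<close>

lemma mellin_iso_D_obj:
  fixes f :: "'a::field_char_0 fls"
  assumes s: "s > 0" and r: "r > 0" and g: "g \<noteq> 0"
    and \<Psi>: "filtered_op d \<Psi>" "bij \<Psi>" "\<And>v N. \<Psi> v \<in> order_ge (N + d) \<longleftrightarrow> v \<in> order_ge N"
    and nabla: "\<And>v. \<Psi> (z_nabla (E_obj r f) v) = - (fls_X_intpow (- int s) * \<Psi> v)"
    and Phi: "\<And>v. \<Psi> (fls_X_intpow (- int r) * v) = g * phi_ext s (\<Psi> v)"
  shows "mellin (E_obj r f) \<simeq>\<^sub>N D_obj s g"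
proof -
  let ?E = "E_obj r f"
  have eqI: "u = v" if "\<Psi> u = \<Psi> v" for u v using \<Psi>(2) that by (simp add: bij_is_inj inj_eq)
  have \<Psi>_inv [simp]: "\<Psi> (inv \<Psi> w) = w" for w using \<Psi>(2) by (simp add: bij_is_surj surj_f_inv_f)
  have E_scale: "conn_scale ?E = ramified_scale r" by (simp add: E_obj_def)
  have cancel: "fls_X_intpow n * (fls_X_intpow (- n) * w) = w" for n and w :: "'a fls"
    by (simp add: shift_1_times)

  have "z_nabla ?E (inv \<Psi> (- (fls_X_intpow (int s) * \<Psi> v))) = v" for v
    by (rule eqI, unfold nabla \<Psi>_inv) (use cancel[of "- int s" "\<Psi> v"] in simp)
  then have "surj (z_nabla ?E)" by (rule surjI)
  then have "\<Psi> v = - (fls_X_intpow (- int s) * \<Psi> (inv (z_nabla ?E) v))" for v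
    unfolding nabla[symmetric] by (simp add: surj_f_inv_f)
  then have theta: "\<Psi> (theta ?E v) = fls_X_intpow (int s) * \<Psi> v" for v
    unfolding theta_def filtered_uminus[OF \<Psi>(1)] using cancel[of "int s"] 
    by (metis mult_minus_right)
  have "theta ?E (inv \<Psi> (fls_X_intpow (- int s) * \<Psi> v)) = v" for v
    by (rule eqI, unfold theta \<Psi>_inv) (rule cancel)
  then have "surj (theta ?E)" by (rule surjI)
  then have "\<Psi> v = fls_X_intpow (int s) * \<Psi> (inv (theta ?E) v)" for v
    unfolding theta[symmetric] by (simp add: surj_f_inv_f)
  then have inv_theta: "\<Psi> (inv (theta ?E) v) = fls_X_intpow (- int s) * \<Psi> v" for v
    using cancel[of "- int s" "\<Psi> (inv (theta ?E) v)"] by (metis minus_minus)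
  have iter: "\<Psi> ((F ^^ k) v) = fls_X_intpow (int k * n) * \<Psi> v"
    if "\<And>v. \<Psi> (F v) = fls_X_intpow n * \<Psi> v" for F n k v
    by (induction k) (simp_all add: that shift_1_times algebra_simps)
  have theta_powi: "\<Psi> (theta_powi ?E n v) = fls_X_intpow (int s * n) * \<Psi> v" for n v
    using iter[of "theta ?E" "int s" "nat n" v, OF theta] 
      iter[of "inv (theta ?E)" "- int s" "nat (- n)" v, OF inv_theta]
    by (simp add: theta_powi_def mult.commute)

  have scale: "\<Psi> (theta_scale ?E h v) = fls_compose_power h s * \<Psi> v" for h v
  proof -
    define S where "S N = (\<Sum>n = fls_subdegree h..int N. 
        conn_scale ?E (fls_const (fls_nth h n)) (theta_powi ?E n v))" for N
    define p where "p N = (\<Sum>n = fls_subdegree h..int N. 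
        fls_const (fls_nth h n) * fls_X_intpow (int s * n))" for N
    define w where "w = inv \<Psi> (fls_compose_power h s * \<Psi> v)"
    have p: "p N - fls_compose_power h s \<in> order_ge (int N + 1)" for N
    proof (rule order_geI)
      fix m assume m: "m < int N + 1"
      have "fls_nth (p N) m = fls_nth (fls_compose_power h s) m"
      proof (cases "int s dvd m")
        case False
        then have "m \<noteq> int s * n" for n by auto
        then show ?thesis using False s by (auto simp: p_def fls_nth_sum fls_nth_compose_power)
      next
        case True
        then obtain k where k: "m = int s * k" by blast
        have "fls_nth (p N) m = (\<Sum>n = fls_subdegree h..int N. if n = k then fls_nth h k else 0)"
          unfolding p_def fls_nth_sum by (intro sum.cong) (use s in \<open>auto simp: k\<close>)
        moreover have "k \<le> int N"
        proof (cases "k > 0")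
          case True
          then have "1 * k \<le> int s * k" using s by (intro mult_right_mono) auto
          then show ?thesis using m k by simp
        qed simp
        ultimately show ?thesis using s by (simp add: k fls_nth_compose_power)
      qed
      then show "fls_nth (p N - fls_compose_power h s) m = 0" by simp
    qed
    have "\<Psi> (S N) = p N * \<Psi> v" for N
      using r by (simp add: S_def p_def filtered_sum[OF \<Psi>(1)] E_scale filtered_scale[OF \<Psi>(1)] 
         theta_powi sum_distrib_right mult.assoc)
    then have \<Psi>_S: "\<Psi> (S N - w) = (p N - fls_compose_power h s) * \<Psi> v" for N
      by (simp add: filtered_diff[OF \<Psi>(1)] w_def left_diff_distrib)
    \<comment> \<open>\<open>\<Psi>(S\<^sub>N - w)\<close> has order at least \<open>N + 1\<close> plus the order of \<open>\<Psi>(v)\<close>, and \<open>\<Psi>\<close> raises orders by \<open>d\<close>.\<close>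
    define l where "l = fls_subdegree (\<Psi> v) - d"
    have S: "S N - w \<in> order_ge (int N + 1 + l)" for N
      using order_ge_mult[OF p in_order_ge_subdegree[of "\<Psi> v"], of N]
      unfolding \<Psi>_S[symmetric] \<Psi>(3)[symmetric, of "S N - w"] by (simp add: l_def add.assoc)
    have "\<forall>\<^sub>F N in sequentially. S N - w \<in> order_ge M" for M
      using eventually_ge_at_top[of "nat (M - l)"]
      by eventually_elim (rule order_ge_mono[OF S], simp)
    then have lim: "adic_limit (conn_scale ?E) S w"
      unfolding E_scale by (rule adic_limitI[OF r])
    have "theta_scale ?E h v = w"
      unfolding theta_scale_def S_def[symmetric, abs_def]
    proof (rule the_equality)
      show "adic_limit (conn_scale ?E) S w" by (rule lim)
      show "w' = w" if "adic_limit (conn_scale ?E) S w'" for w'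
        using adic_limit_unique[OF r] that lim unfolding E_scale by blast
    qed
    then show ?thesis by (simp add: w_def)
  qed

  show ?thesis
  proof (rule diff_mod_iso_transport[OF is_diff_mod_D_obj[OF s g] \<Psi>(2) filtered_add[OF \<Psi>(1)]])
    show "\<Psi> (dm_scale (mellin ?E) h v) = dm_scale (D_obj s g) h (\<Psi> v)" for h v
      by (simp add: mellin_def D_obj_def scale)
    show "\<Psi> (dm_Phi (mellin ?E) v) = dm_Phi (D_obj s g) (\<Psi> v)" for v
      using Phi[of v] r by (simp add: mellin_def D_obj_def E_scale)
  qed
qed

section \<open>Solving the system\<close>

text \<open>Apart from a root of the constant term, the root is a binomial series.\<close>

lemma fps_inverse_nth_root_ex:
  fixes F :: "'a::{alg_closed_field, field_char_0} fps"
  assumes s: "s > 0" and F: "fps_nth F 0 \<noteq> 0"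
  shows "\<exists>w. w ^ s * F = 1"
proof -
  let ?a = "fps_nth F 0"
  define U where "U = fps_const (1 / ?a) * F - 1"
  have U0: "fps_nth U 0 = 0" using F by (simp add: U_def)
  have F_U: "F = fps_const ?a * (1 + U)"
    using F by (simp add: U_def fps_eq_iff)
  obtain c where c: "c ^ s = 1 / ?a" using nth_root_exists[OF s] by blast
  define w where "w = fps_compose (fps_binomial (- (1 / of_nat s))) U"
  have "w ^ s = fps_compose (fps_binomial (- 1)) U"
    using s by (simp add: w_def fps_compose_power[OF U0] fps_binomial_power)
  moreover have "fps_compose (fps_binomial (- 1)) U * fps_compose (fps_binomial 1) U = 1"
    by (simp add: flip: fps_compose_mult_distrib[OF U0] fps_binomial_add_mult)
  moreover have "fps_compose (fps_binomial 1) U = 1 + U"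
    by (simp add: fps_binomial_1 fps_compose_add_distrib U0)
  ultimately have "w ^ s * (1 + U) = 1" by simp
  moreover have "(fps_const c * w) ^ s * F = fps_const (c ^ s * ?a) * (w ^ s * (1 + U))"
    by (subst F_U) (simp add: power_mult_distrib fps_const_power flip: fps_const_mult)
  ultimately show ?thesis using c F by (intro exI[of _ "fps_const c * w"]) simp
qed

text \<open>Choose a uniformizer \<open>\<rho>\<close> with \<open>f \<rho>\<^sup>s = -1\<close>. Substituting \<open>t\<close> shows that \<open>f(t) = - x\<^sup>-\<^sup>s\<close> is equivalent
  to \<open>\<rho>(t)\<^sup>s = x\<^sup>s\<close>, that is, to \<open>\<rho>(t) = \<omega> x\<close> with \<open>\<omega>\<^sup>s = 1\<close>; so \<open>t\<^sub>0\<close> is the compositional inverse of \<open>\<rho>\<close>.\<close>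

lemma substitution_solutions:
  fixes f :: "'a::{alg_closed_field, field_char_0} fls"
  assumes s: "s > 0" and f: "fls_subdegree f = - int s"
  obtains t0 where "subdegree t0 = 1" "fls_compose_fps f t0 = - fls_X_intpow (- int s)"
    "\<And>t. subdegree t = 1 \<Longrightarrow> fls_compose_fps f t = - fls_X_intpow (- int s) \<Longrightarrow>
       \<exists>\<omega>. \<omega> ^ s = 1 \<and> t = fps_compose t0 (fps_const \<omega> * fps_X)"
proof -
  define F where "F = fls_regpart (fls_X_intpow (int s) * f)"
  have f_0: "f \<noteq> 0" using f s by auto
  have "fps_to_fls F = fls_X_intpow (int s) * f"
    unfolding F_def by (rule order_ge_0_regpart, unfold order_ge_mult_intpow_iff)
      (use in_order_ge_subdegree[of f] f in simp)
  then have f_F: "f = fls_X_intpow (- int s) * fps_to_fls F" by (simp add: shift_1_times)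
  have "fps_nth F 0 = fls_nth f (fls_subdegree f)" by (simp add: F_def shift_1_times f)
  then have "fps_nth (- F) 0 \<noteq> 0" using f_0 by simp
  from fps_inverse_nth_root_ex[OF s this] obtain w where w: "w ^ s * - F = 1" by blast
  have w0: "fps_nth w 0 \<noteq> 0"
  proof
    assume "fps_nth w 0 = 0"
    then have "fps_nth (w ^ s * - F) 0 = 0" using s by simp
    then show False unfolding w by simp
  qed
  define \<rho> where "\<rho> = fps_X * w"
  have \<rho>: "fps_nth \<rho> 0 = 0" "fps_nth \<rho> 1 \<noteq> 0" using w0 by (simp_all add: \<rho>_def fps_X_mult_nth)
  then have "subdegree \<rho> = 1" by (simp only: subdegree_eq_1_iff) simp
  have f_\<rho>: "f * fps_to_fls \<rho> ^ s = - 1"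
  proof -
    have "f * fps_to_fls \<rho> ^ s = (fls_X_intpow (- int s) * fls_X ^ s) * (fps_to_fls w ^ s * fps_to_fls F)"
      unfolding f_F \<rho>_def by (simp add: fls_times_fps_to_fls power_mult_distrib)
    also have "fls_X_intpow (- int s) * fls_X ^ s = (1 :: 'a fls)"
      by (simp add: fls_X_power_conv_shift_1 shift_1_times)
    also have "fps_to_fls w ^ s * fps_to_fls F = fps_to_fls (w ^ s * F)"
      by (simp add: fls_times_fps_to_fls fps_to_fls_power)
    also have "w ^ s * F = - 1" using w by (metis minus_minus mult_minus_right)
    finally show ?thesis by simp
  qed
  have subst: "fls_compose_fps f t * fps_to_fls (fps_compose \<rho> t) ^ s = - 1" 
    if t: "fps_nth t 0 = 0" "t \<noteq> 0" for t
    using arg_cong[OF f_\<rho>, of "\<lambda>v. fls_compose_fps v t"] t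
    by (simp add: fls_compose_fps_mult fls_compose_fps_power fls_compose_fps_to_fls)
  define t0 where "t0 = fps_inv \<rho>"
  have \<rho>_t0: "fps_compose \<rho> t0 = fps_X" and t0_\<rho>: "fps_compose t0 \<rho> = fps_X"
    unfolding t0_def using fps_inv_right[OF \<rho>] fps_inv[OF \<rho>] by auto
  have "fps_nth (fps_compose t0 \<rho>) 0 = 0" unfolding t0_\<rho> by simp
  then have t0_0: "fps_nth t0 0 = 0" by simp
  have t0_nz: "t0 \<noteq> 0" using t0_\<rho> by (metis fps_X_neq_zero fps_compose_0)
  have "fls_subdegree (fps_to_fls (fps_compose t0 \<rho>)) = int (subdegree t0)"
    using subdegree_fls_compose_fps[OF \<rho>(1), of "fps_to_fls t0"] \<open>subdegree \<rho> = 1\<close> \<rho>(1)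
    by (simp add: fls_compose_fps_to_fls fls_subdegree_fls_to_fps)
  then have sub: "subdegree t0 = 1" unfolding t0_\<rho> by simp
  have unit: "fls_X_intpow (- int s) * fls_X ^ s = (1 :: 'a fls)"
    by (simp add: fls_X_power_conv_shift_1 shift_1_times)
  have inv: "fls_compose_fps f t0 * fls_X ^ s = - 1"
    using subst[OF t0_0 t0_nz] unfolding \<rho>_t0 by simp
  have "fls_compose_fps f t0 = fls_compose_fps f t0 * (fls_X_intpow (- int s) * fls_X ^ s)"
    unfolding unit by simp
  also have "\<dots> = (fls_compose_fps f t0 * fls_X ^ s) * fls_X_intpow (- int s)"
    by (simp only: mult_ac)
  finally have eq: "fls_compose_fps f t0 = - fls_X_intpow (- int s)" unfolding inv by simp
  show ?thesis
  proof (rule that[OF sub eq])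
    fix t assume sub_t: "subdegree t = 1" and f_t: "fls_compose_fps f t = - fls_X_intpow (- int s)"
    have t: "fps_nth t 0 = 0" "t \<noteq> 0" using sub_t subdegree_eq_1_iff[of t] by auto
    define y where "y = fps_compose \<rho> t"
    have "- fls_X_intpow (- int s) * fps_to_fls y ^ s = - 1"
      using subst[OF t] unfolding f_t y_def .
    then have "fls_X_intpow (- int s) * fps_to_fls y ^ s = fls_X_intpow (- int s) * fls_X ^ s"
      unfolding unit by simp
    then have "fps_to_fls y ^ s = fls_X ^ s"
      by (subst (asm) mult_left_cancel) (simp_all add: fls_shift_eq0_iff)
    then have y_s: "y ^ s = fps_X ^ s"
      by (metis fps_X_to_fls fps_to_fls_eq_iff fps_to_fls_power)
    define y1 where "y1 = fps_shift 1 y"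
    have "fps_nth y 0 = 0" using \<rho>(1) by (simp add: y_def)
    then have y: "y = fps_X * y1" by (intro fps_ext) (simp add: y1_def fps_X_mult_nth)
    \<comment> \<open>A root of unity in the power series ring has derivative \<open>0\<close>, hence is constant.\<close>
    have y1_s: "y1 ^ s = 1" using y_s unfolding y power_mult_distrib by simp
    then have "of_nat s * y1 ^ (s - 1) * fps_deriv y1 = 0"
      using fps_deriv_power[of y1 s] by (simp add: mult_ac)
    moreover have "y1 \<noteq> 0" using y1_s s by (auto simp: power_0_left)
    ultimately have "fps_deriv y1 = 0" using s by simp
    then obtain \<omega> where \<omega>: "y1 = fps_const \<omega>" by (metis fps_deriv_eq_0_iff)
    have "\<omega> ^ s = 1" using arg_cong[OF y1_s, of "\<lambda>p. fps_nth p 0"] by (simp add: \<omega>)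
    moreover have "t = fps_compose t0 y"
      unfolding y_def fps_compose_assoc[OF t(1) \<rho>(1)] t0_\<rho> using t(1) by simp
    ultimately show "\<exists>\<omega>. \<omega> ^ s = 1 \<and> t = fps_compose t0 (fps_const \<omega> * fps_X)"
      unfolding y \<omega> by (auto simp: mult.commute)
  qed
qed

lemma galois_nth: "\<eta> \<noteq> 0 \<Longrightarrow> fls_nth (galois \<eta> v) n = fls_nth v n * \<eta> powi n"
  unfolding galois_def by (rule fls_nth_fls_compose_fps_linear)

lemma galois_mult: "\<eta> \<noteq> 0 \<Longrightarrow> galois \<eta> (u * v) = galois \<eta> u * galois \<eta> v"
  unfolding galois_def by (rule fls_compose_fps_mult) (auto simp: fps_eq_iff)

lemma galois_powi: "\<eta> \<noteq> 0 \<Longrightarrow> galois \<eta> (u powi n) = galois \<eta> u powi n"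
  unfolding galois_def by (rule fls_compose_fps_powi) (auto simp: fps_eq_iff)

lemma galois_fps_to_fls:
  "\<eta> \<noteq> 0 \<Longrightarrow> galois \<eta> (fps_to_fls p) = fps_to_fls (fps_compose p (fps_const \<eta> * fps_X))"
  unfolding galois_def by (rule fls_compose_fps_to_fls) (auto simp: fps_eq_iff)

lemma powi_of_root_of_unity_dvd:
  fixes \<epsilon> :: "'a::field"
  assumes "\<epsilon> ^ d = 1" "int d dvd n"
  shows "\<epsilon> powi n = 1"
proof -
  from assms(2) obtain k where "n = int d * k" by blast
  then show ?thesis using assms(1) power_int_mult[of \<epsilon> "int d" k] by simp
qed

text \<open>The series \<open>g\<close> as a function of \<open>t\<close> alone: the root \<open>b\<close> in the system is the leading coefficient
  of \<open>z = t\<^sup>-\<^sup>r\<close>.\<close>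

definition system_value :: "nat \<Rightarrow> nat \<Rightarrow> 'a::field fps \<Rightarrow> 'a fls" where
  "system_value s r t = fps_to_fls t powi (- int r) -
     fls_const (fps_nth t 1 powi (- int r) * (of_nat (r + s) / of_nat (2 * s))) *
       fls_X_intpow (int s - int r)"

lemma powi_neg_leading:
  assumes "subdegree (t :: 'a::field fps) = 1"
  shows "fls_subdegree (fps_to_fls t powi (- int r)) = - int r"
    and "fls_nth (fps_to_fls t powi (- int r)) (- int r) = fps_nth t 1 powi (- int r)"
  using fls_nth_powi_leading[of "fps_to_fls t" "- int r"] assms
  by (simp_all add: fls_subdegree_fls_to_fps)

lemma mellin_system_iff:
  fixes f :: "'a::field_char_0 fls"
  assumes s: "s > 0" and a: "a \<noteq> 0" and f: "fls_subdegree f = - int s" "fls_nth f (- int s) = a"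
  shows "mellin_system s r a f g \<longleftrightarrow> (\<exists>t. subdegree t = 1 \<and> 
    fls_compose_fps f t = - fls_X_intpow (- int s) \<and> g = system_value s r t)"
proof
  assume "mellin_system s r a f g"
  from mellin_systemE[OF this s a f(1)] obtain t z b where t: "subdegree t = 1" 
    and z: "z = fps_to_fls t powi (- int r)"
    and f_t: "fls_compose_fps f t = - fls_X_intpow (- int s)"
    and lead: "fls_nth z (- int r) = b"
    and g: "g = z - fls_const (b * (of_nat (r + s) / of_nat (2 * s))) * fls_X_intpow (int s - int r)"
    by blast
  have "b = fps_nth t 1 powi (- int r)" using powi_neg_leading(2)[OF t, of r] lead z by simp
  then have "g = system_value s r t" unfolding system_value_def g z by (rule arg_cong)
  then show "\<exists>t. subdegree t = 1 \<and> 
    fls_compose_fps f t = - fls_X_intpow (- int s) \<and> g = system_value s r t"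
    using t f_t by blast
next
  assume "\<exists>t. subdegree t = 1 \<and> fls_compose_fps f t = - fls_X_intpow (- int s) \<and> g = system_value s r t"
  then obtain t where t: "subdegree t = 1" and f_t: "fls_compose_fps f t = - fls_X_intpow (- int s)"
    and g: "g = system_value s r t" by blast
  let ?c = "fps_nth t 1" and ?z = "fps_to_fls t powi (- int r)"
  have t0: "fps_nth t 0 = 0" "t \<noteq> 0" "?c \<noteq> 0" using t subdegree_eq_1_iff[of t] by auto
  have f_ge: "f \<in> order_ge (- int s)" using in_order_ge_subdegree[of f] f by simp
  have "fls_nth (fls_compose_fps f t) (- int s) = a * ?c powi (- int s)"
    using filtered_leading[OF fls_compose_fps_filtered[OF t] f_ge]
      fls_compose_fps_intpow_leading[OF t, of "- int s"] by (simp add: f)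
  then have "- 1 = a * ?c powi (- int s)" unfolding f_t by simp
  then have "a = - (?c ^ s)" using t0(3) by (simp add: power_int_minus field_simps)
  then have "?c ^ s = - a" by simp
  then have root: "(?c powi (- int r)) ^ s = (- a) powi (- int r)"
    by (metis power_int_mult power_int_of_nat mult.commute)
  have "?z * fps_to_fls t ^ r = 1" using t0 by (simp add: power_int_minus)
  moreover have "?z - fls_const (?c powi (- int r)) * fls_X powi (- int r) \<in> small_o (- int r)"
    using order_ge_leading_term[OF in_order_ge_subdegree[of ?z]] 
    unfolding small_o_eq_order_ge fls_X_power_int powi_neg_leading[OF t] .
  ultimately show "mellin_system s r a f g"
    unfolding mellin_system_def fls_X_power_int 
    using t0(1) f_t root g[unfolded system_value_def] by blast
qed

text \<open>Why different choices of roots give the same Galois orbit; the correction term in \<open>g\<close> transforms like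
  the leading term of \<open>z\<close> because \<open>\<omega>\<^sup>s = 1\<close>.\<close>

lemma system_value_galois:
  assumes "subdegree t = 1" "\<omega> ^ s = 1" "s > 0"
  shows "system_value s r (fps_compose t (fps_const \<omega> * fps_X)) = galois \<omega> (system_value s r t)"
proof -
  have \<omega>: "\<omega> \<noteq> 0" using assms(2,3) by (auto simp: power_0_left)
  have 1: "fps_nth (fps_compose t (fps_const \<omega> * fps_X)) 1 = \<omega> * fps_nth t 1"
    by (simp add: fps_compose_linear)
  have z: "fps_to_fls (fps_compose t (fps_const \<omega> * fps_X)) powi n = galois \<omega> (fps_to_fls t powi n)" for n
    by (simp add: galois_powi[OF \<omega>] galois_fps_to_fls[OF \<omega>])
  have "\<omega> powi n = \<omega> powi (- int r)" if "n + int r = int s" for n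
  proof -
    have "n = int s + - int r" using that by simp
    then show ?thesis using \<omega> assms(2) by (simp only: power_int_add[OF disjI1[OF \<omega>]]) simp
  qed
  then show ?thesis
    unfolding system_value_def z 1 
    by (intro fls_eqI) (simp add: galois_nth[OF \<omega>] power_int_mult_distrib algebra_simps)
qed

section \<open>The class of \<open>g\<close> is not defined over a smaller field\<close>

text \<open>A zero of \<open>1 + x + \<dots> + x\<^sup>d\<^sup>-\<^sup>1\<close>, which takes the value \<open>d \<noteq> 0\<close> at \<open>1\<close>.\<close>

lemma nontrivial_root_of_unity_ex:
  assumes "d > 1"
  shows "\<exists>\<epsilon> :: 'a::{alg_closed_field, field_char_0}. \<epsilon> ^ d = 1 \<and> \<epsilon> \<noteq> 1"
proof -
  obtain x :: 'a where x: "(\<Sum>k\<le>d - 1. 1 * x ^ k) = 0"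
    using alg_closed[of "d - 1" "\<lambda>_. 1 :: 'a"] assms by auto
  have "{..d - 1} = {..<d}" using assms by auto
  then have sum: "(\<Sum>k<d. x ^ k) = 0" using x by simp
  then have "x \<noteq> 1" using assms by auto
  moreover have "x ^ d - 1 = (x - 1) * (\<Sum>k<d. x ^ k)"
    by (rule power_diff_1_eq)
  ultimately show ?thesis unfolding sum by auto
qed

lemma powi_congruent_1:
  fixes u :: "'a::field fls"
  assumes u: "u - 1 \<in> order_ge k" and k: "k \<ge> 1"
  shows "u powi n - 1 \<in> order_ge k"
proof -
  have pow: "w ^ j - 1 \<in> order_ge k" if w: "w - 1 \<in> order_ge k" for w :: "'a fls" and j
  proof (induction j)
    case (Suc j)
    have "w ^ Suc j - 1 = (w ^ j - 1) * (w - 1) + (w ^ j - 1) + (w - 1)"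
      by (simp add: algebra_simps)
    moreover have "(w ^ j - 1) * (w - 1) \<in> order_ge k"
      using order_ge_mult[OF Suc w] by (rule order_ge_mono) (use k in simp)
    ultimately show ?case using Suc w by (metis order_ge_add)
  qed simp
  have u_nth: "fls_nth u m = (if m = 0 then 1 else 0)" if "m \<le> 0" for m
    using order_geD[OF u, of m] k that by (simp split: if_splits)
  then have u0: "fls_subdegree u = 0" by (intro fls_subdegree_eqI) auto
  have "u \<noteq> 0" using u_nth[of 0] by auto
  then have "inverse u - 1 = - ((u - 1) * inverse u)" by (simp add: field_simps)
  moreover have "inverse u \<in> order_ge 0"
    using inverse_in_order_ge[of u] by (simp add: u0)
  ultimately have "inverse u - 1 \<in> order_ge k"
    using order_ge_mult[OF u, of "inverse u" 0] by simp
  then show ?thesis using pow[OF u] pow by (simp add: power_int_def)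
qed

text \<open>In characteristic \<open>0\<close> the factor \<open>1 + y + \<dots> + y\<^sup>r\<^sup>-\<^sup>1\<close> of \<open>y\<^sup>r - 1\<close> is a unit when \<open>y\<close> has
  constant term \<open>1\<close>.\<close>

lemma congruent_1_of_power:
  fixes y :: "'a::field_char_0 fls"
  assumes r: "r > 0" and y: "y - 1 \<in> order_ge 1" and y_r: "y ^ r - 1 \<in> order_ge k"
  shows "y - 1 \<in> order_ge k"
proof -
  define S where "S = (\<Sum>i<r. y ^ i)"
  have "S - of_nat r = (\<Sum>i<r. y powi int i - 1)" by (simp add: S_def sum_subtractf)
  also have "\<dots> \<in> order_ge 1" by (intro order_ge_sum powi_congruent_1 y) simp
  finally have S: "S - of_nat r \<in> order_ge 1" .
  have S_nth: "fls_nth S m = (if m = 0 then of_nat r else 0)" if "m \<le> 0" for m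
    using order_geD[OF S, of m] that by (simp add: fls_of_nat_nth)
  then have S0: "fls_subdegree S = 0" using r by (intro fls_subdegree_eqI) auto
  have S_nz: "S \<noteq> 0" using S_nth[of 0] r by auto
  have "y ^ r - 1 = (y - 1) * S" unfolding S_def by (rule power_diff_1_eq)
  then have "y - 1 = (y ^ r - 1) * inverse S" using S_nz by (simp add: field_simps)
  moreover have "inverse S \<in> order_ge 0"
    using inverse_in_order_ge[of S] by (simp add: S0)
  ultimately show ?thesis using order_ge_mult[OF y_r, of "inverse S" 0] by simp
qed

text \<open>On monomials this is the congruence for integer powers of \<open>A/B\<close>.\<close>

lemma fls_compose_fps_congruent:
  fixes A B :: "'a::field fps"
  assumes A: "subdegree A = 1" and B: "subdegree B = 1" and k: "k \<ge> 1"
    and AB: "fps_to_fls A / fps_to_fls B - 1 \<in> order_ge k" and v: "v \<in> order_ge N"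
  shows "fls_compose_fps v A - fls_compose_fps v B \<in> order_ge (N + k)"
proof -
  have A0: "fps_nth A 0 = 0" "A \<noteq> 0" and B0: "fps_nth B 0 = 0" "B \<noteq> 0"
    using A B subdegree_eq_1_iff[of A] subdegree_eq_1_iff[of B] by auto
  have "filtered_op k (\<lambda>v. fls_compose_fps v A - fls_compose_fps v B)"
  proof (rule filtered_op_improve)
    show "filtered_op 0 (\<lambda>v. fls_compose_fps v A - fls_compose_fps v B)"
      by (intro filtered_op_diff fls_compose_fps_filtered A B)
    fix n
    let ?u = "fps_to_fls A / fps_to_fls B"
    have "fls_compose_fps (fls_X_intpow n) A - fls_compose_fps (fls_X_intpow n) B =
        fps_to_fls B powi n * (?u powi n - 1)"
      unfolding fls_compose_fps_intpow[OF A0] fls_compose_fps_intpow[OF B0]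
      using B0 by (simp add: power_int_divide_distrib field_simps)
    moreover have "fps_to_fls B powi n \<in> order_ge n"
      using powi_in_order_ge[of "fps_to_fls B" n] by (simp add: fls_subdegree_fls_to_fps B)
    ultimately show "fls_compose_fps (fls_X_intpow n) A - fls_compose_fps (fls_X_intpow n) B 
        \<in> order_ge (n + k)"
      using order_ge_mult powi_congruent_1[OF AB k] by metis
  qed
  from filtered_order[OF this v] show ?thesis .
qed

text \<open>The hypothesis on \<open>z\<close> says that \<open>z(\<epsilon> x)\<close> agrees with \<open>z(x)\<close> up to relative order \<open>s\<close>. Taking
  \<open>r\<close>-th roots, \<open>t(\<epsilon> x)\<close> agrees with \<open>\<epsilon> t(x)\<close> to the same precision, so \<open>f(t(\<epsilon> x)) = - (\<epsilon> x)\<^sup>-\<^sup>s = f(t(x))\<close>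
  agrees with \<open>f(\<epsilon> t(x))\<close> modulo positive powers. Undoing the substitution, \<open>f(\<epsilon> u)\<close> agrees with \<open>f(u)\<close>
  modulo positive powers.\<close>

lemma galois_invariance_of_f:
  fixes t :: "'a::field_char_0 fps" and \<epsilon> :: 'a
  assumes s: "s > 0" and r: "r > 0" and t: "subdegree t = 1"
    and f: "fls_subdegree f = - int s" and f_t: "fls_compose_fps f t = - fls_X_intpow (- int s)"
    and \<epsilon>: "\<epsilon> ^ s = 1"
    and z: "\<And>n. n \<le> int s - int r \<Longrightarrow> fls_nth (fps_to_fls t powi (- int r)) n \<noteq> 0 \<Longrightarrow> \<epsilon> powi n = 1"
  shows "\<epsilon> ^ r = 1" and "\<And>n. n \<le> 0 \<Longrightarrow> fls_nth f n \<noteq> 0 \<Longrightarrow> \<epsilon> powi n = 1"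
proof -
  have \<epsilon>_0: "\<epsilon> \<noteq> 0" using \<epsilon> s by (auto simp: power_0_left)
  have t0: "fps_nth t 0 = 0" "t \<noteq> 0" "fps_nth t 1 \<noteq> 0" using t subdegree_eq_1_iff[of t] by auto
  let ?t = "fps_to_fls t" and ?z = "fps_to_fls t powi (- int r)"
  have z_sub: "fls_subdegree ?z = - int r" and z_0: "?z \<noteq> 0"
    using powi_neg_leading(1)[OF t, of r] t0 by simp_all
  have "fls_nth ?z (- int r) \<noteq> 0" unfolding powi_neg_leading(2)[OF t] using t0 by simp
  then have "\<epsilon> powi (- int r) = 1" using z[of "- int r"] s by simp
  then show \<epsilon>_r: "\<epsilon> ^ r = 1" by (simp add: power_int_minus)
  \<comment> \<open>\<open>A = \<epsilon> t(x)\<close> and \<open>B = t(\<epsilon> x)\<close>.\<close>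
  define A where "A = fps_const \<epsilon> * t"
  define B where "B = fps_compose t (fps_const \<epsilon> * fps_X)"
  have A: "subdegree A = 1" unfolding subdegree_eq_1_iff A_def using t0 \<epsilon>_0 by simp
  have B: "subdegree B = 1" unfolding subdegree_eq_1_iff B_def using t0 \<epsilon>_0 
    by (simp add: fps_compose_linear)
  have B0: "B \<noteq> 0" "fps_nth B 0 = 0" "fps_nth B 1 = \<epsilon> * fps_nth t 1" 
    using B subdegree_eq_1_iff[of B] by (auto simp: B_def fps_compose_linear)
  define y where "y = fps_to_fls A / fps_to_fls B"
  have "y ^ r - 1 \<in> order_ge (int s + 1)"
  proof -
    have "y ^ r = (fps_to_fls t ^ r) / fps_to_fls B ^ r"
      unfolding y_def A_def by (simp add: power_divide power_mult_distrib fls_times_fps_to_fls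
        \<epsilon>_r flip: fls_const_power)
    also have "\<dots> = (fps_to_fls B powi (- int r)) / ?z"
      by (simp add: power_int_minus divide_inverse)
    also have "fps_to_fls B powi (- int r) = galois \<epsilon> ?z"
      unfolding B_def galois_powi[OF \<epsilon>_0] galois_fps_to_fls[OF \<epsilon>_0] ..
    finally have "y ^ r - 1 = (galois \<epsilon> ?z - ?z) * inverse ?z"
      using z_0 by (simp add: field_simps)
    moreover have "galois \<epsilon> ?z - ?z \<in> order_ge (int s - int r + 1)"
      by (rule order_geI) (use z in \<open>auto simp: galois_nth[OF \<epsilon>_0]\<close>)
    moreover have "inverse ?z \<in> order_ge (int r)"
      using inverse_in_order_ge[of ?z] unfolding z_sub minus_minus .
    ultimately show ?thesis using order_ge_mult by fastforce
  qed
  moreover have "y - 1 \<in> order_ge 1"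
  proof -
    have "fps_to_fls A - fps_to_fls B \<in> order_ge 2"
    proof (rule order_geI)
      fix n :: int assume n: "n < 2"
      consider "n < 0" | "n = 0" | "n = 1" using n by linarith
      then show "fls_nth (fps_to_fls A - fps_to_fls B) n = 0"
        by cases (use t0 B0 in \<open>simp_all add: A_def\<close>)
    qed
    moreover have "inverse (fps_to_fls B) \<in> order_ge (- 1)"
      using inverse_in_order_ge[of "fps_to_fls B"] 
      by (simp add: fls_subdegree_fls_to_fps B)
    ultimately have "(fps_to_fls A - fps_to_fls B) * inverse (fps_to_fls B) \<in> order_ge (2 + - 1)"
      by (rule order_ge_mult)
    then show ?thesis using B0 by (simp add: y_def field_simps)
  qed
  ultimately have "y - 1 \<in> order_ge (int s + 1)" using congruent_1_of_power[OF r] by blast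
  then have "fls_compose_fps f A - fls_compose_fps f B \<in> order_ge (- int s + (int s + 1))"
    unfolding y_def by (intro fls_compose_fps_congruent A B) (use in_order_ge_subdegree[of f] f in simp_all)
  moreover have "fls_compose_fps f A = fls_compose_fps (galois \<epsilon> f) t"
  proof -
    have "fps_compose (fps_const \<epsilon> * fps_X) t = A"
      using t0 by (simp add: A_def fps_compose_mult_distrib)
    then show ?thesis unfolding galois_def
      by (subst fls_compose_fps_assoc) (use t0 \<epsilon>_0 in auto)
  qed
  moreover have "fls_compose_fps f B = fls_compose_fps f t"
  proof -
    have "\<epsilon> powi n = 1" if "n + int s = 0" for n
    proof -
      have "n = - int s" using that by simp
      then show ?thesis using powi_of_root_of_unity_dvd[OF \<epsilon>, of n] by simp
    qed
    then have \<epsilon>_s: "galois \<epsilon> (fls_X_intpow (- int s)) = fls_X_intpow (- int s)"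
      by (intro fls_eqI) (auto simp: galois_nth[OF \<epsilon>_0])
    have "fls_compose_fps f B = galois \<epsilon> (fls_compose_fps f t)"
      unfolding galois_def B_def by (subst fls_compose_fps_assoc) (use t0 \<epsilon>_0 in auto)
    also have "\<dots> = fls_compose_fps f t"
      unfolding f_t using \<epsilon>_s by (simp add: galois_def)
    finally show ?thesis .
  qed
  ultimately have "fls_compose_fps (galois \<epsilon> f - f) t \<in> order_ge (1 + 0)"
    by (simp add: fls_compose_fps_diff[OF t0(2,1)])
  then have "galois \<epsilon> f - f \<in> order_ge 1"
    by (subst (asm) filtered_order_iff[OF fls_compose_fps_filtered[OF t]])
      (use t0 in \<open>simp_all add: fls_compose_fps_intpow_leading[OF t]\<close>)
  then show "\<epsilon> powi n = 1" if "n \<le> 0" "fls_nth f n \<noteq> 0" for n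
    using order_geD[of "galois \<epsilon> f - f" 1 n] that by (simp add: galois_nth[OF \<epsilon>_0])
qed

text \<open>A nontrivial \<open>r\<close>-th root of unity \<open>\<epsilon>\<close> of order \<open>e\<close> that fixes \<open>f\<close> modulo positive powers
  would put the class of \<open>f\<close> into \<open>k((\<zeta>\<^sup>e\<^sup>/\<^sup>r))\<close>.\<close>

lemma R_circ_no_invariance:
  fixes f :: "'a::field_char_0 fls" and \<epsilon> :: 'a
  assumes R: "R_rel r `` {f} \<in> R_circ r" and r: "r > 0"
    and \<epsilon>: "\<epsilon> ^ r = 1" and inv: "\<And>n. n \<le> 0 \<Longrightarrow> fls_nth f n \<noteq> 0 \<Longrightarrow> \<epsilon> powi n = 1"
  shows "\<epsilon> = 1"
proof (rule ccontr)
  assume \<epsilon>_1: "\<epsilon> \<noteq> 1"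
  have \<epsilon>_0: "\<epsilon> \<noteq> 0" using \<epsilon> r by (auto simp: power_0_left)
  define e where "e = (LEAST k. k > 0 \<and> \<epsilon> ^ k = 1)"
  have e: "e > 0" "\<epsilon> ^ e = 1" using LeastI[of "\<lambda>k. k > 0 \<and> \<epsilon> ^ k = 1" r] r \<epsilon> by (auto simp: e_def)
  have dvd: "int e dvd n" if "\<epsilon> powi n = 1" for n
  proof -
    define m where "m = nat (n mod int e)"
    have m: "int m = n mod int e" using e by (simp add: m_def)
    have "\<epsilon> powi n = \<epsilon> powi (int e * (n div int e)) * \<epsilon> powi (int m)"
      unfolding m using \<epsilon>_0 by (subst power_int_add[symmetric]) auto
    then have "\<epsilon> ^ m = 1"
      using that powi_of_root_of_unity_dvd[OF e(2), of "int e * (n div int e)"] by simp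
    moreover have "m < e" using e m by (metis of_nat_0_less_iff of_nat_less_iff pos_mod_bound)
    ultimately have "m = 0" using not_less_Least[of m "\<lambda>k. k > 0 \<and> \<epsilon> ^ k = 1"] by (auto simp: e_def)
    then show ?thesis using m by (simp add: dvd_eq_mod_eq_0)
  qed
  have "e dvd r" using dvd[of "int r"] \<epsilon> by simp
  then obtain q' where q': "r = e * q'" by (auto simp: dvd_def)
  have "e \<noteq> 1" using e \<epsilon>_1 by auto
  then have q'_less: "0 < q'" "q' < r" using q' r e by auto
  \<comment> \<open>Dropping the positive powers of \<open>f\<close> stays in its class and leaves exponents divisible by \<open>e\<close>.\<close>
  define p where "p = fps_to_fls (Abs_fps (\<lambda>k. if k = 0 then 0 else fls_nth f (int k)))"
  have p_nth: "fls_nth p n = (if n \<le> 0 then 0 else fls_nth f n)" for n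
    by (simp add: p_def)
  have "galois 1 f = f" by (intro fls_eqI) (simp add: galois_nth)
  moreover have "- p \<in> small_o 0" by (simp add: small_o_def p_nth)
  ultimately have "(f, f - p) \<in> R_rel r"
    unfolding R_rel_def
    by (intro CollectI case_prodI exI[of _ 1] exI[of _ "0 :: int"] bexI[of _ "- p"]) simp_all
  then have "f - p \<in> R_rel r `` {f}" by blast
  moreover have "f - p \<in> in_subfield r q'"
    unfolding in_subfield_def
  proof (intro CollectI allI impI)
    fix n assume "fls_nth (f - p) n \<noteq> 0"
    then have "int e dvd n" by (intro dvd inv) (auto simp: p_nth split: if_splits)
    then show "int r dvd n * int q'" unfolding q' by simp
  qed
  ultimately show False using R q'_less unfolding R_circ_def by blast
qed

lemma
  assumes t: "subdegree (t :: 'a::field fps) = 1" and s: "s > 0"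
  shows system_value_order_ge: "system_value s r t \<in> order_ge (- int r)"
    and system_value_nonzero: "system_value s r t \<noteq> 0"
proof -
  let ?z = "fps_to_fls t powi (- int r)"
  have z: "?z \<in> order_ge (- int r)" "fls_nth ?z (- int r) \<noteq> 0"
    using in_order_ge_subdegree[of ?z] powi_neg_leading[OF t, of r] t subdegree_eq_1_iff[of t] by auto
  show "system_value s r t \<in> order_ge (- int r)"
    unfolding system_value_def by (intro order_ge_diff z order_ge_const_mult) simp
  have "fls_nth (system_value s r t) (- int r) = fls_nth ?z (- int r)"
    using s by (simp add: system_value_def)
  then show "system_value s r t \<noteq> 0" using z(2) by auto
qed

text \<open>Suppose that the class of \<open>g\<close> contains a series in \<open>\<theta>\<^sup>d\<^sup>/\<^sup>s\<close> with \<open>d > 1\<close>. A root of unity \<open>\<epsilon> \<noteq> 1\<close> with \<open>\<epsilon>\<^sup>d = 1\<close>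
  fixes that series. The elements of the subgroup and the correction term in \<open>g\<close> are fixed by \<open>\<epsilon>\<close> up to
  relative order \<open>s\<close>, hence so is \<open>z\<close>; then \<open>\<epsilon>\<close> fixes \<open>f\<close> modulo positive powers, against \<open>f \<in> R\<^sup>\<circ>\<close>.\<close>

lemma system_value_class_in_S_circ:
  fixes f :: "'a::{alg_closed_field, field_char_0} fls"
  assumes s: "s > 0" and r: "r > 0" and R: "R_rel r `` {f} \<in> R_circ r"
    and f: "fls_subdegree f = - int s" and t: "subdegree t = 1" 
    and f_t: "fls_compose_fps f t = - fls_X_intpow (- int s)"
  shows "S_rel s `` {system_value s r t} \<in> S_circ s"
proof -
  let ?g = "system_value s r t" and ?z = "fps_to_fls t powi (- int r)"
  note g = system_value_order_ge[OF t s, of r] system_value_nonzero[OF t s, of r]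
  have "S_rel s `` {?g} \<inter> in_subfield s q' = {}" if q': "0 < q'" "q' < s" for q'
  proof (rule ccontr)
    assume "S_rel s `` {?g} \<inter> in_subfield s q' \<noteq> {}"
    then obtain g' \<eta> h where g': "g' \<in> in_subfield s q'" "g' = galois \<eta> ?g * h" and \<eta>: "\<eta> ^ s = 1"
      and h: "h \<in> S_subgroup s"
      unfolding S_rel_def by blast
    have \<eta>_0: "\<eta> \<noteq> 0" using \<eta> s by (auto simp: power_0_left)
    define c where "c = gcd s q'"
    obtain d q1 where d: "s = d * c" and q1: "q' = q1 * c" and coprime: "coprime d q1"
      using gcd_coprime_exists[of s q'] s unfolding c_def by (metis gcd_eq_0_iff neq0_conv)
    have c_0: "c > 0" using s by (simp add: c_def)
    have "d > 1"
    proof (rule ccontr)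
      assume "\<not> d > 1"
      then have "s \<le> c" using d by (cases d) auto
      also have "c \<le> q'" unfolding c_def using q' by (simp add: gcd_le2_nat)
      finally show False using q' by simp
    qed
    then obtain \<epsilon> :: 'a where \<epsilon>: "\<epsilon> ^ d = 1" "\<epsilon> \<noteq> 1" using nontrivial_root_of_unity_ex by blast
    have \<epsilon>_s: "\<epsilon> ^ s = 1" unfolding d power_mult \<epsilon>(1) by simp
    have \<epsilon>_0: "\<epsilon> \<noteq> 0" using \<epsilon>_s s by (auto simp: power_0_left)
    have g'_inv: "galois \<epsilon> g' = g'"
    proof (rule fls_eqI)
      fix n
      show "fls_nth (galois \<epsilon> g') n = fls_nth g' n"
      proof (cases "fls_nth g' n = 0")
        case False
        then have "int (d * c) dvd n * int (q1 * c)" using g'(1) unfolding in_subfield_def d q1 by blast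
        then have "int d * int c dvd (n * int q1) * int c" by (simp add: mult_ac)
        then have "int d dvd n * int q1" using c_0 by (metis dvd_mult_cancel_right of_nat_0_less_iff less_irrefl)
        then have "int d dvd n" using coprime by (simp add: coprime_dvd_mult_left_iff)
        then show ?thesis using powi_of_root_of_unity_dvd[OF \<epsilon>(1)] by (simp add: galois_nth[OF \<epsilon>_0])
      qed (simp add: galois_nth[OF \<epsilon>_0])
    qed
    from h obtain m p where h_eq: "h = 1 + fls_const (of_int m / of_nat s) * fls_X ^ s + p"
      and p: "p \<in> order_ge (int s + 1)"
      unfolding S_subgroup_def small_o_eq_order_ge by blast
    have h_nth: "fls_nth h n = (if n = 0 then 1 else if n = int s then of_int m / of_nat s else 0)"
      if "n \<le> int s" for n
      using order_geD[OF p, of n] that s by (simp add: h_eq fls_X_power_conv_shift_1)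
    have h_inv: "h - galois \<epsilon> h \<in> order_ge (int s + 1)"
      by (rule order_geI) (use \<epsilon>_s in \<open>simp add: galois_nth[OF \<epsilon>_0] h_nth\<close>)
    have h_sub: "fls_subdegree h = 0" by (rule fls_subdegree_eqI) (use h_nth in auto)
    have h_0: "h \<noteq> 0" using h_nth[of 0] by auto
    let ?G = "galois \<eta> ?g"
    have "galois \<epsilon> ?G * galois \<epsilon> h = ?G * h"
      using g'_inv unfolding g'(2) galois_mult[OF \<epsilon>_0] .
    then have "(galois \<epsilon> ?G - ?G) * h = galois \<epsilon> ?G * (h - galois \<epsilon> h)"
      by (simp add: algebra_simps)
    then have G_eq: "galois \<epsilon> ?G - ?G = galois \<epsilon> ?G * (h - galois \<epsilon> h) * inverse h"
      using h_0 by (simp add: field_simps)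
    have "galois \<epsilon> ?G \<in> order_ge (- int r)"
      using g(1) by (simp add: order_ge_def galois_nth[OF \<epsilon>_0] galois_nth[OF \<eta>_0])
    moreover have "inverse h \<in> order_ge 0"
      using inverse_in_order_ge[of h] by (simp add: h_sub)
    ultimately have "galois \<epsilon> ?G - ?G \<in> order_ge (- int r + (int s + 1) + 0)"
      unfolding G_eq using h_inv by (intro order_ge_mult)
    then have g_inv: "\<epsilon> powi n = 1" if "n \<le> int s - int r" "fls_nth ?g n \<noteq> 0" for n
      using order_geD[of "galois \<epsilon> ?G - ?G" _ n] that \<eta>_0
      by (simp add: galois_nth[OF \<epsilon>_0] galois_nth[OF \<eta>_0])
    have "fls_nth ?g (- int r) \<noteq> 0"
      using s powi_neg_leading(2)[OF t, of r] t subdegree_eq_1_iff[of t] by (simp add: system_value_def)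
    then have "\<epsilon> powi (- int r) = 1" using g_inv[of "- int r"] s by simp
    then have \<epsilon>_sr: "\<epsilon> powi (int s - int r) = 1"
      using \<epsilon>_s \<epsilon>_0 power_int_add[of \<epsilon> "int s" "- int r"] by simp
    have z_inv: "\<epsilon> powi n = 1" if "n \<le> int s - int r" "fls_nth ?z n \<noteq> 0" for n
    proof (cases "n = int s - int r")
      case False
      then have "fls_nth ?g n = fls_nth ?z n" by (simp add: system_value_def)
      then show ?thesis using g_inv that by simp
    qed (simp add: \<epsilon>_sr)
    have "\<epsilon> = 1"
      using R_circ_no_invariance[OF R r] galois_invariance_of_f[OF s r t f f_t \<epsilon>_s z_inv] by blast
    then show False using \<epsilon>(2) by simp
  qed
  moreover have "S_rel s `` {?g} \<in> S_set s"
    unfolding S_set_def by (rule quotientI) (use g(2) in simp)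
  ultimately show ?thesis unfolding S_circ_def by blast
qed

theorem theorem10p4:
  fixes s r :: nat
    and a :: "'a::{alg_closed_field, field_char_0}"
    and f :: "'a fls"
  assumes "s > 0" and "r > 0" and "a \<noteq> 0"
    and "R_rel r `` {f} \<in> R_circ r"
    and "f - fls_const a * fls_X powi (- int s) \<in> small_o (- int s)"
  shows "\<exists>C \<in> S_circ s. (\<exists>g. mellin_system s r a f g) \<and>
           (\<forall>g. mellin_system s r a f g \<longrightarrow> g \<in> C \<and> mellin (E_obj r f) \<simeq>\<^sub>N D_obj s g)"
proof -
  note s = assms(1) and r = assms(2) and a = assms(3)
  have "f - fls_const a * fls_X_intpow (- int s) \<in> order_ge (- int s + 1)"
    using assms(5) unfolding small_o_eq_order_ge fls_X_power_int .
  note f = fls_subdegree_eq_of_leading_term[OF a this]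
  note system_iff = mellin_system_iff[OF s a f]
  obtain t0 where t0: "subdegree t0 = 1" "fls_compose_fps f t0 = - fls_X_intpow (- int s)"
    and t0_unique: "\<And>t. subdegree t = 1 \<Longrightarrow> fls_compose_fps f t = - fls_X_intpow (- int s) \<Longrightarrow>
       \<exists>\<omega>. \<omega> ^ s = 1 \<and> t = fps_compose t0 (fps_const \<omega> * fps_X)"
    using substitution_solutions[OF s f(1)] by blast
  let ?g0 = "system_value s r t0"
  show ?thesis
  proof (intro bexI[of _ "S_rel s `` {?g0}"] conjI allI impI)
    show "S_rel s `` {?g0} \<in> S_circ s"
      by (rule system_value_class_in_S_circ[OF s r assms(4) f(1) t0])
    show "\<exists>g. mellin_system s r a f g"
      using system_iff t0 by blast
    fix g assume g: "mellin_system s r a f g"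
    then obtain t where t: "subdegree t = 1" "fls_compose_fps f t = - fls_X_intpow (- int s)"
      "g = system_value s r t"
      using system_iff by blast
    obtain \<omega> where \<omega>: "\<omega> ^ s = 1" "t = fps_compose t0 (fps_const \<omega> * fps_X)"
      using t0_unique[OF t(1,2)] by blast
    have g_g0: "g = galois \<omega> ?g0"
      unfolding t(3) \<omega>(2) by (rule system_value_galois[OF t0(1) \<omega>(1) s])
    have g_0: "g \<noteq> 0" unfolding t(3) by (rule system_value_nonzero[OF t(1) s])
    have "1 \<in> S_subgroup s"
      unfolding S_subgroup_def by (auto intro!: exI[of _ 0] simp: small_o_def)
    then show "g \<in> S_rel s `` {?g0}"
      using g_0 system_value_nonzero[OF t0(1) s] \<omega>(1) g_g0
      unfolding S_rel_def by (auto intro!: exI[of _ \<omega>] bexI[of _ 1])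
    from mellin_intertwiner_ex[OF g s r a f(1)] show "mellin (E_obj r f) \<simeq>\<^sub>N D_obj s g"
      using mellin_iso_D_obj[OF s r g_0] by metis
  qed
qed

end
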